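(* Let $d\geq2$ be an integer and $w\geq\bigl(3d+2+\sqrt{9d^2+4d+4}\bigr)/2$ a real number. Let $a,b$ be distinct positive integers. Define $(a_{n,w})_{n\geq1}$ by $a_{n,w}=b$ if $n=\lfloor w^i\rfloor$ for some integer $i\geq0$, and $a_{n,w}=a$ otherwise. Let $\xi_w:=[0,a_{1,w},a_{2,w},\ldots]\in\mathbb{R}$ (regular continued fraction). Then \[ w_n^{*}(\xi_w)=w-1,\qquad w_n(\xi_w)=w \] for all $2\leq n\leq d$.
   Context: For a real number $\xi$ and an integer $n\geq1$: $w_n(\xi)$ is the supremum of real $w$ such that $0<|P(\xi)|\leq H(P)^{-w}$ for infinitely many $P\in\mathbb{Z}[X]$ of degree at most $n$, where $H(P)$ is the maximum of the absolute values of the coefficients of $P$; $w_n^{*}(\xi)$ is the supremum of real $w^*$ such that $0<|\xi-\alpha|\leq H(\alpha)^{-w^*-1}$ for infinitely many real algebraic numbers $\alpha$ of degree at most $n$, where $H(\alpha)$ is the height of the minimal polynomial of $\alpha$ over $\mathbb{Z}$. *)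

theory Defs
  imports "HOL-Analysis.Analysis" "HOL-Computational_Algebra.Computational_Algebra"
begin

definition poly_height :: "int poly \<Rightarrow> int" where
  "poly_height P = Max ((\<lambda>i. \<bar>coeff P i\<bar>) ` {..degree P})"

text \<open>
  The minimal polynomial over the integers is normalised to be primitive with positive
  leading coefficient, which makes it unique (see the lemmas below).
\<close>

definition is_int_min_poly :: "real \<Rightarrow> int poly \<Rightarrow> bool" where
  "is_int_min_poly \<alpha> P \<longleftrightarrow>
     poly (map_poly of_int P) \<alpha> = 0 \<and> content P = 1 \<and> lead_coeff P > 0 \<and>
     (\<forall>Q :: int poly. Q \<noteq> 0 \<longrightarrow> poly (map_poly of_int Q) \<alpha> = 0 \<longrightarrow> degree P \<le> degree Q)"

definition int_min_poly :: "real \<Rightarrow> int poly" where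
  "int_min_poly \<alpha> = (THE P. is_int_min_poly \<alpha> P)"

definition alg_degree :: "real \<Rightarrow> nat" where
  "alg_degree \<alpha> = degree (int_min_poly \<alpha>)"

definition alg_height :: "real \<Rightarrow> int" where
  "alg_height \<alpha> = poly_height (int_min_poly \<alpha>)"

text \<open>
  The suprema are taken in the extended reals, so that the value \<open>\<infinity>\<close> is possible.
  In both definitions the base of \<open>powr\<close> is at least 1: a polynomial \<open>P\<close>
  with \<open>P(\<xi>) \<noteq> 0\<close> and a minimal polynomial are nonzero.
\<close>

definition w_exp :: "nat \<Rightarrow> real \<Rightarrow> ereal" where
  "w_exp n \<xi> = Sup {ereal w | w :: real.
     infinite {P :: int poly. degree P \<le> n \<and> 0 < \<bar>poly (map_poly of_int P) \<xi>\<bar> \<and>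
       \<bar>poly (map_poly of_int P) \<xi>\<bar> \<le> of_int (poly_height P) powr (- w)}}"

definition w_star_exp :: "nat \<Rightarrow> real \<Rightarrow> ereal" where
  "w_star_exp n \<xi> = Sup {ereal w | w :: real.
     infinite {\<alpha> :: real. algebraic \<alpha> \<and> alg_degree \<alpha> \<le> n \<and> 0 < \<bar>\<xi> - \<alpha>\<bar> \<and>
       \<bar>\<xi> - \<alpha>\<bar> \<le> of_int (alg_height \<alpha>) powr (- w - 1)}}"

fun finite_cfrac :: "int list \<Rightarrow> real" where
  "finite_cfrac [] = 0"
| "finite_cfrac [c] = of_int c"
| "finite_cfrac (c # c' # cs) = of_int c + 1 / finite_cfrac (c' # cs)"

definition cfrac_value :: "(nat \<Rightarrow> int) \<Rightarrow> real" where
  "cfrac_value c = lim (\<lambda>n. finite_cfrac (map c [0..<Suc n]))"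

definition a_seq :: "int \<Rightarrow> int \<Rightarrow> real \<Rightarrow> nat \<Rightarrow> int" where
  "a_seq a b w n = (if \<exists>i::nat. int n = \<lfloor>w ^ i\<rfloor> then b else a)"

definition xi :: "int \<Rightarrow> int \<Rightarrow> real \<Rightarrow> real" where
  "xi a b w = cfrac_value (\<lambda>n. if n = 0 then 0 else a_seq a b w n)"

lemma is_int_min_poly_unique:
  assumes "is_int_min_poly \<alpha> P" "is_int_min_poly \<alpha> Q"
  shows "P = Q"
proof -
  have P: "poly (map_poly of_int P) \<alpha> = 0" "content P = 1" "lead_coeff P > 0"
    "\<And>R :: int poly. R \<noteq> 0 \<Longrightarrow> poly (map_poly of_int R) \<alpha> = 0 \<Longrightarrow> degree P \<le> degree R"
    using assms(1) unfolding is_int_min_poly_def by blast+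
  have Q: "poly (map_poly of_int Q) \<alpha> = 0" "content Q = 1" "lead_coeff Q > 0"
    "\<And>R :: int poly. R \<noteq> 0 \<Longrightarrow> poly (map_poly of_int R) \<alpha> = 0 \<Longrightarrow> degree Q \<le> degree R"
    using assms(2) unfolding is_int_min_poly_def by blast+
  have nz: "P \<noteq> 0" "Q \<noteq> 0" using P(3) Q(3) by auto
  have deg: "degree P = degree Q"
    using P(4)[OF nz(2) Q(1)] Q(4)[OF nz(1) P(1)] by simp
  have pos: "degree P > 0"
  proof (rule ccontr)
    assume "\<not> degree P > 0"
    then obtain c where c: "P = [:c:]" by (meson degree_eq_zeroE gr0I)
    then show False using P(1) nz by (simp add: map_poly_pCons)
  qed
  define R where "R = smult (lead_coeff Q) P - smult (lead_coeff P) Q"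
  have map_R: "map_poly real_of_int R =
      smult (of_int (lead_coeff Q)) (map_poly of_int P) -
      smult (of_int (lead_coeff P)) (map_poly of_int Q)"
    by (rule poly_eqI) (simp add: R_def coeff_map_poly)
  have root: "poly (map_poly of_int R) \<alpha> = 0"
    by (simp add: map_R P(1) Q(1))
  have "R = 0"
  proof (rule ccontr)
    assume "R \<noteq> 0"
    then have ge: "degree P \<le> degree R" using P(4) root by blast
    have "degree R \<le> degree P"
      unfolding R_def by (rule degree_diff_le) (use deg in auto)
    with ge have "coeff R (degree P) = lead_coeff R" by simp
    moreover have "coeff R (degree P) = 0"
      by (simp add: R_def deg)
    ultimately show False using \<open>R \<noteq> 0\<close> by simp
  qed
  then have eq: "smult (lead_coeff Q) P = smult (lead_coeff P) Q"
    by (simp add: R_def)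
  from arg_cong[OF this, of content] have "lead_coeff Q = lead_coeff P"
    using P(2,3) Q(2,3) by simp
  with eq nz show ?thesis by (metis smult_eq_iff leading_coeff_0_iff smult_cancel)
qed

lemma is_int_min_poly_int_min_poly:
  assumes "algebraic \<alpha>"
  shows "is_int_min_poly \<alpha> (int_min_poly \<alpha>)"
proof -
  let ?S = "\<lambda>Q :: int poly. Q \<noteq> 0 \<and> poly (map_poly of_int Q) \<alpha> = 0"
  obtain p where p: "\<forall>i. coeff p i \<in> \<int>" "p \<noteq> 0" "poly p \<alpha> = 0"
    using assms unfolding algebraic_def by blast
  have "map_poly real_of_int (map_poly floor p) = p"
    using p(1) by (intro poly_eqI) (auto simp: coeff_map_poly elim: Ints_cases)
  with p have "?S (map_poly floor p)" by auto
  then obtain Q where Q: "?S Q" "\<And>R. ?S R \<Longrightarrow> degree Q \<le> degree R"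
    using ex_has_least_nat[of ?S _ degree] by blast
  define c where "c = sgn (lead_coeff Q) * content Q"
  define P where "P = smult (sgn (lead_coeff Q)) (primitive_part Q)"
  have s: "sgn (lead_coeff Q) = 1 \<or> sgn (lead_coeff Q) = -1"
    using Q(1) by (simp add: sgn_if)
  have "smult c P = Q"
    using s by (auto simp: c_def P_def)
  have c0: "c \<noteq> 0" using Q(1) s by (auto simp: c_def)
  have map_Q: "map_poly real_of_int Q = smult (of_int c) (map_poly of_int P)"
    by (subst \<open>smult c P = Q\<close>[symmetric]) (rule poly_eqI, simp add: coeff_map_poly)
  have "poly (map_poly of_int P) \<alpha> = 0"
    using Q(1) c0 unfolding map_Q by simp
  moreover have "content P = 1"
    using s Q(1) by (auto simp: P_def content_smult)
  moreover have "lead_coeff P > 0"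
  proof -
    have "lead_coeff Q = c * lead_coeff P"
      using \<open>smult c P = Q\<close> by (metis lead_coeff_smult)
    moreover have "content Q > 0" using Q(1) by (simp add: content_def order_less_le)
    ultimately have "content Q * lead_coeff P = \<bar>lead_coeff Q\<bar>"
      using s by (auto simp: c_def abs_sgn)
    also have "\<dots> > 0" using Q(1) by simp
    finally show ?thesis
      using \<open>content Q > 0\<close> by (simp add: zero_less_mult_iff)
  qed
  moreover have "degree P = degree Q"
    using \<open>smult c P = Q\<close> c0 by (metis degree_smult_eq)
  ultimately have "is_int_min_poly \<alpha> P"
    using Q(2) unfolding is_int_min_poly_def by auto
  then show ?thesis
    unfolding int_min_poly_def by (metis theI is_int_min_poly_unique)
qed

end

theory Submission
  imports Defs
begin

text \<open>
  Truncating the expansion of \<open>\<xi>\<close> after the \<open>j\<close>-th digit \<open>b\<close> and continuing with the digit \<open>a\<close>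
  forever gives a quadratic number \<open>\<alpha>\<^sub>j\<close>, whose minimal polynomial \<open>F\<^sub>j\<close> has height comparable to
  some \<open>T\<^sub>j\<close> with \<open>ln T\<^sub>j\<^sub>+\<^sub>1 \<sim> w ln T\<^sub>j\<close>, and both \<open>|\<xi> - \<alpha>\<^sub>j|\<close> and \<open>|F\<^sub>j(\<xi>)|\<close> are comparable to
  \<open>1 / T\<^sub>j\<^sub>+\<^sub>1\<close>. (The conjugate of \<open>\<alpha>\<^sub>j\<close> is so close to \<open>\<alpha>\<^sub>j\<close> that \<open>F\<^sub>j'(\<alpha>\<^sub>j)\<close> is bounded.) This
  gives both lower bounds.

  Conversely let \<open>P\<close> have degree at most \<open>n\<close> and height \<open>H\<close>. If \<open>P(\<alpha>\<^sub>j) \<noteq> 0\<close>, taking norms shows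
  \<open>|P(\<alpha>\<^sub>j)| \<ge> c / (H T\<^sub>j\<^sup>n)\<close>, and for the least \<open>j\<close> with \<open>T\<^sub>j\<^sub>+\<^sub>1 \<ge> C H\<^sup>2 T\<^sub>j\<^sup>n\<close> this is inherited by
  \<open>P(\<xi>)\<close>. For that \<open>j\<close> one has \<open>T\<^sub>j \<le> H\<close> to the power \<open>2 w / (w - n)\<close>, up to an arbitrarily small
  change of the exponent, and the hypothesis on \<open>w\<close>, which reads \<open>2 n w \<le> (w - 2) (w - n)\<close> for
  \<open>n = d\<close>, turns the bound into \<open>|P(\<xi>)| \<ge> H\<close> to the power \<open>-(w - 1) - \<eta>\<close>. Factors \<open>F\<^sub>j\<close> of \<open>P\<close> are
  split off by induction on the degree; they obey the weaker exponent \<open>w\<close> and are the only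
  minimal polynomials to do so, while their roots are at distance at least \<open>H\<close> to the power
  \<open>-w - \<eta>\<close> from \<open>\<xi>\<close>.
\<close>

section \<open>Integer polynomials and heights\<close>

abbreviation rpoly :: "int poly \<Rightarrow> real \<Rightarrow> real" where
  "rpoly P x \<equiv> poly (map_poly of_int P) x"

lemma map_poly_of_int_mult:
  "map_poly real_of_int (P * Q) = map_poly of_int P * map_poly of_int Q"
  by (rule poly_eqI) (simp add: coeff_map_poly coeff_mult)

lemma map_poly_of_int_add:
  "map_poly real_of_int (P + Q) = map_poly of_int P + map_poly of_int Q"
  by (rule poly_eqI) (simp add: coeff_map_poly)

lemma map_poly_of_int_smult:
  "map_poly real_of_int (smult c P) = smult (of_int c) (map_poly of_int P)"
  by (rule poly_eqI) (simp add: coeff_map_poly)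

lemma rpoly_as_sum:
  assumes "degree P \<le> n"
  shows "rpoly P x = (\<Sum>i\<le>n. of_int (coeff P i) * x ^ i)"
proof -
  have "rpoly P x = (\<Sum>i\<le>degree (map_poly real_of_int P). coeff (map_poly of_int P) i * x ^ i)"
    by (rule poly_altdef)
  also have "\<dots> = (\<Sum>i\<le>n. coeff (map_poly of_int P) i * x ^ i)"
    using assms
    by (intro sum.mono_neutral_left) (auto simp: not_le coeff_eq_0 degree_map_poly)
  finally show ?thesis by (simp add: coeff_map_poly)
qed

lemma abs_coeff_le_poly_height: "\<bar>coeff P i\<bar> \<le> poly_height P"
proof (cases "i \<le> degree P")
  case True
  then show ?thesis unfolding poly_height_def by (intro Max_ge) auto
next
  case False
  have "\<bar>coeff P 0\<bar> \<le> poly_height P" unfolding poly_height_def by (intro Max_ge) auto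
  with False show ?thesis by (simp add: coeff_eq_0)
qed

lemma poly_height_ge_1:
  assumes "P \<noteq> 0"
  shows "poly_height P \<ge> 1"
  using abs_coeff_le_poly_height[of P "degree P"] assms
  by (smt (verit) leading_coeff_0_iff)

lemma poly_height_obtain:
  obtains i where "poly_height P = \<bar>coeff P i\<bar>"
proof -
  have "poly_height P \<in> (\<lambda>i. \<bar>coeff P i\<bar>) ` {..degree P}"
    unfolding poly_height_def by (rule Max_in) auto
  then show ?thesis using that by blast
qed

lemma finite_int_poly_bounded_height:
  "finite {P :: int poly. degree P \<le> n \<and> poly_height P \<le> B}"
proof -
  have "{P :: int poly. degree P \<le> n \<and> poly_height P \<le> B}
      \<subseteq> Poly ` {xs. set xs \<subseteq> {-B..B} \<and> length xs = Suc n}"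
  proof safe
    fix P :: "int poly" assume P: "degree P \<le> n" "poly_height P \<le> B"
    have "coeff P i \<in> {-B..B}" for i
      using abs_coeff_le_poly_height[of P i] P(2) by auto
    moreover have "P = Poly (map (coeff P) [0..<Suc n])"
      by (rule poly_eqI) (use P(1) in \<open>auto simp: nth_default_def coeff_eq_0 simp del: upt_Suc\<close>)
    ultimately show "P \<in> Poly ` {xs. set xs \<subseteq> {-B..B} \<and> length xs = Suc n}"
      by (intro image_eqI[where x = "map (coeff P) [0..<Suc n]"]) auto
  qed
  then show ?thesis
    by (rule finite_subset) (intro finite_imageI finite_lists_length_eq, simp)
qed

lemma abs_power_diff_le:
  fixes x y :: real
  assumes "\<bar>x\<bar> \<le> 2" "\<bar>y\<bar> \<le> 2"
  shows "\<bar>x ^ i - y ^ i\<bar> \<le> real i * 2 ^ i * \<bar>x - y\<bar>"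
proof (induction i)
  case (Suc i)
  have "x ^ Suc i - y ^ Suc i = x * (x ^ i - y ^ i) + (x - y) * y ^ i"
    by (simp add: algebra_simps)
  also have "\<bar>\<dots>\<bar> \<le> \<bar>x\<bar> * \<bar>x ^ i - y ^ i\<bar> + \<bar>x - y\<bar> * \<bar>y\<bar> ^ i"
    by (metis abs_mult abs_triangle_ineq power_abs)
  also have "\<dots> \<le> 2 * (real i * 2 ^ i * \<bar>x - y\<bar>) + \<bar>x - y\<bar> * 2 ^ i"
    using assms Suc.IH by (intro add_mono mult_mono power_mono) auto
  also have "\<dots> \<le> real (Suc i) * 2 ^ Suc i * \<bar>x - y\<bar>"
    by (simp add: algebra_simps)
  finally show ?case .
qed simp

text \<open>The constant is crude: n + 1 terms, each with Lipschitz constant at most n 2^n. The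
  range up to 2 leaves room for algebraic numbers within distance 1 of \<xi>.\<close>

lemma rpoly_lipschitz:
  assumes "degree P \<le> n" "\<bar>x\<bar> \<le> 2" "\<bar>y\<bar> \<le> 2"
  shows "\<bar>rpoly P x - rpoly P y\<bar> \<le> (real (Suc n) * real n * 2 ^ n) * of_int (poly_height P) * \<bar>x - y\<bar>"
proof -
  have "rpoly P x - rpoly P y = (\<Sum>i\<le>n. of_int (coeff P i) * (x ^ i - y ^ i))"
    by (simp add: rpoly_as_sum[OF assms(1)] sum_subtractf algebra_simps)
  also have "\<bar>\<dots>\<bar> \<le> (\<Sum>i\<le>n. \<bar>of_int (coeff P i) * (x ^ i - y ^ i)\<bar>)"
    by (rule sum_abs)
  also have "\<dots> \<le> (\<Sum>i\<le>n. of_int (poly_height P) * (real n * 2 ^ n * \<bar>x - y\<bar>))"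
  proof (rule sum_mono)
    fix i assume i: "i \<in> {..n}"
    have h: "\<bar>real_of_int (coeff P i)\<bar> \<le> of_int (poly_height P)"
      using abs_coeff_le_poly_height[of P i] by linarith
    have "\<bar>x ^ i - y ^ i\<bar> \<le> real i * 2 ^ i * \<bar>x - y\<bar>"
      using assms by (intro abs_power_diff_le) auto
    also have "\<dots> \<le> real n * 2 ^ n * \<bar>x - y\<bar>"
      using i by (intro mult_mono) (auto intro: power_increasing)
    finally show "\<bar>of_int (coeff P i) * (x ^ i - y ^ i)\<bar> \<le> of_int (poly_height P) * (real n * 2 ^ n * \<bar>x - y\<bar>)"
      unfolding abs_mult using h by (intro mult_mono) auto
  qed
  also have "\<dots> = (real (Suc n) * real n * 2 ^ n) * of_int (poly_height P) * \<bar>x - y\<bar>"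
    by (simp add: algebra_simps)
  finally show ?thesis .
qed

text \<open>Pseudo-division by \<open>Q\<close> leaves a remainder that vanishes at \<alpha> and is
  0 or of smaller degree, hence is 0; Gauss's lemma then removes the multiplier.\<close>

lemma is_int_min_poly_dvd:
  assumes m: "is_int_min_poly \<alpha> Q" and P: "rpoly P \<alpha> = 0"
  shows "Q dvd P"
proof -
  have Q: "rpoly Q \<alpha> = 0" "content Q = 1" "lead_coeff Q > 0"
    "\<And>R :: int poly. R \<noteq> 0 \<Longrightarrow> rpoly R \<alpha> = 0 \<Longrightarrow> degree Q \<le> degree R"
    using m unfolding is_int_min_poly_def by blast+
  have Q0: "Q \<noteq> 0" using Q(3) by auto
  obtain q r where qr: "pseudo_divmod P Q = (q, r)" by force
  define c where "c = lead_coeff Q ^ (Suc (degree P) - degree Q)"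
  have eq: "smult c P = Q * q + r" and r: "r = 0 \<or> degree r < degree Q"
    using pseudo_divmod[OF Q0 qr] by (auto simp: c_def)
  have c0: "c > 0" using Q(3) by (simp add: c_def)
  have "rpoly r \<alpha> = 0"
    using arg_cong[OF eq, of "\<lambda>p. rpoly p \<alpha>"] P Q(1)
    by (simp add: map_poly_of_int_mult map_poly_of_int_add map_poly_of_int_smult)
  then have "r = 0" using r Q(4)[of r] by force
  with eq have eq': "smult c P = Q * q" by simp
  \<comment> \<open>\<open>Q\<close> is primitive and the content is multiplicative, so the factor
    \<open>c\<close> sits in the content of \<open>q\<close> and can be cancelled.\<close>
  from arg_cong[OF this, of content] have "content q = c * content P"
    using Q(2) c0 by (simp add: content_mult)
  then have "q = smult (c * content P) (primitive_part q)"
    by (metis content_times_primitive_part)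
  then have "smult c P = smult c (Q * smult (content P) (primitive_part q))"
    using eq' by (metis mult_smult_right smult_smult)
  then have "P = Q * smult (content P) (primitive_part q)"
    using c0 by (metis smult_cancel less_numeral_extra(3))
  then show ?thesis by (metis dvd_triv_left)
qed

lemma is_int_min_poly_eq_int_min_poly:
  assumes "is_int_min_poly \<alpha> P"
  shows "algebraic \<alpha>" "int_min_poly \<alpha> = P"
proof -
  show "int_min_poly \<alpha> = P"
    unfolding int_min_poly_def using assms is_int_min_poly_unique by blast
  show "algebraic \<alpha>"
    unfolding algebraic_def
    by (rule exI[of _ "map_poly of_int P"])
      (use assms in \<open>auto simp: is_int_min_poly_def coeff_map_poly map_poly_eq_0_iff\<close>)
qed

text \<open>Comparing coefficients in \<open>F * R\<close> expresses each coefficient of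
  \<open>R\<close>, times the leading one of \<open>F\<close>, through the two next higher ones, so
  they can be bounded from the top downwards. The loss depends only on \<open>k\<close> and
  \<open>m\<close>: splitting off a quadratic factor divides the height by about the size of that
  factor.\<close>

lemma quadratic_quotient_height:
  fixes F R :: "int poly" and k :: real
  assumes deg: "degree F = 2" and F: "\<And>i. \<bar>real_of_int (coeff F i)\<bar> \<le> k * of_int \<bar>lead_coeff F\<bar>"
    and R: "degree R \<le> m" and k: "k \<ge> 0"
  shows "real_of_int \<bar>lead_coeff F\<bar> * of_int (poly_height R) \<le> (2 * k + 1) ^ Suc m * of_int (poly_height (F * R))"
proof -
  define A where "A = real_of_int \<bar>lead_coeff F\<bar>"
  define H where "H = real_of_int (poly_height (F * R))"
  define r where "r = (\<lambda>i. \<bar>real_of_int (coeff R i)\<bar>)"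
  have Feq: "F = [:coeff F 0, coeff F 1, coeff F 2:]"
    by (rule poly_eqI) (use deg in \<open>auto simp: coeff_pCons coeff_eq_0 numeral_2_eq_2 split: nat.splits\<close>)
  have rec: "coeff (F * R) (Suc (Suc i)) = coeff F 2 * coeff R i + coeff F 1 * coeff R (Suc i)
      + coeff F 0 * coeff R (Suc (Suc i))" for i
    by (subst Feq) (simp add: algebra_simps)
  have A0: "A \<ge> 0" by (simp add: A_def)
  have "\<bar>coeff (F * R) 0\<bar> \<le> poly_height (F * R)"
    by (rule abs_coeff_le_poly_height)
  then have H0: "H \<ge> 0" by (simp add: H_def)
  \<comment> \<open>\<open>i\<close> counts the steps down from index m + 1, where the coefficients
    of \<open>R\<close> vanish; each step costs a factor 2 k + 1.\<close>
  have bound: "Suc m \<le> j + i \<Longrightarrow> A * r j \<le> H * (2 * k + 1) ^ i" for i j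
  proof (induction i arbitrary: j)
    case 0
    then have "coeff R j = 0" using R by (intro coeff_eq_0) auto
    then show ?case using H0 by (simp add: r_def)
  next
    case (Suc i)
    have c2: "A * r j = \<bar>real_of_int (coeff F 2 * coeff R j)\<bar>"
      by (simp add: A_def r_def deg abs_mult)
    have "real_of_int (coeff F 2 * coeff R j) = of_int (coeff (F * R) (Suc (Suc j)))
        - of_int (coeff F 1) * of_int (coeff R (Suc j)) - of_int (coeff F 0) * of_int (coeff R (Suc (Suc j)))"
      by (simp add: rec)
    then have "A * r j \<le> \<bar>of_int (coeff (F * R) (Suc (Suc j)))\<bar>
        + \<bar>of_int (coeff F 1)\<bar> * r (Suc j) + \<bar>of_int (coeff F 0)\<bar> * r (Suc (Suc j))"
      unfolding c2 unfolding r_def abs_mult[symmetric] by linarith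
    also have "\<dots> \<le> H + (k * A) * r (Suc j) + (k * A) * r (Suc (Suc j))"
      using F abs_coeff_le_poly_height[of "F * R" "Suc (Suc j)"]
      by (intro add_mono mult_right_mono) (auto simp: A_def H_def r_def)
    also have "\<dots> = H + k * (A * r (Suc j)) + k * (A * r (Suc (Suc j)))" by simp
    also have "\<dots> \<le> H * (2 * k + 1) ^ i + k * (H * (2 * k + 1) ^ i) + k * (H * (2 * k + 1) ^ i)"
      using Suc H0 k by (intro add_mono mult_left_mono) (auto simp: mult_le_cancel_left1)
    also have "\<dots> = H * (2 * k + 1) ^ Suc i" by (simp add: algebra_simps)
    finally show ?case .
  qed
  obtain i where i: "poly_height R = \<bar>coeff R i\<bar>" by (rule poly_height_obtain)
  have "A * r i \<le> H * (2 * k + 1) ^ Suc m" by (rule bound) auto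
  then show ?thesis by (simp add: A_def H_def r_def i mult.commute del: power_Suc)
qed

text \<open>The two powers of the height are compatible only for bounded height. \<open>v\<close> is
  kept abstract because it will be |P(\<xi>)| in one case and the distance from \<xi> to a root of
  \<open>P\<close> in the other.\<close>

lemma finite_polys_if_lower_bound:
  fixes v :: "int poly \<Rightarrow> real"
  assumes c: "c > 0" and bound: "\<And>P. P \<in> S \<Longrightarrow> c * of_int (poly_height P) powr - s \<le> v P"
    and S: "\<And>P. P \<in> S \<Longrightarrow> P \<noteq> 0 \<and> degree P \<le> n \<and> v P \<le> of_int (poly_height P) powr - t"
    and st: "s < t"
  shows "finite S"
proof -
  define B where "B = \<lceil>(1 / c) powr (1 / (t - s))\<rceil>"
  have "poly_height P \<le> B" if P: "P \<in> S" for P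
  proof -
    let ?H = "real_of_int (poly_height P)"
    have H: "?H \<ge> 1" using poly_height_ge_1 S[OF P] by simp
    have "c * ?H powr - s \<le> ?H powr - t" using bound[OF P] S[OF P] by linarith
    then have "c * (?H powr - s * ?H powr t) \<le> ?H powr - t * ?H powr t"
      by (metis mult.assoc mult_right_mono powr_ge_zero)
    then have "c * ?H powr (t - s) \<le> 1" using H by (simp flip: powr_add)
    then have "?H powr (t - s) \<le> 1 / c" using c by (simp add: field_simps)
    then have "(?H powr (t - s)) powr (1 / (t - s)) \<le> (1 / c) powr (1 / (t - s))"
      using st by (intro powr_mono2) auto
    then have "?H \<le> (1 / c) powr (1 / (t - s))" using H st by (simp add: powr_powr)
    then show ?thesis unfolding B_def by linarith
  qed
  then have "S \<subseteq> {P. degree P \<le> n \<and> poly_height P \<le> B}" using S by auto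
  then show ?thesis using finite_int_poly_bounded_height finite_subset by blast
qed

lemma Sup_ereal_eqI:
  assumes lower: "\<And>v. 0 < v \<Longrightarrow> v < u \<Longrightarrow> A v" and upper: "\<And>v. u < v \<Longrightarrow> \<not> A v" and u: "u > (0 :: real)"
  shows "Sup {ereal v | v. A v} = ereal u"
proof (rule antisym)
  show "Sup {ereal v | v. A v} \<le> ereal u"
    by (rule Sup_least) (use upper in \<open>force simp: not_less[symmetric]\<close>)
  show "ereal u \<le> Sup {ereal v | v. A v}"
  proof (rule dense_le)
    fix y assume y: "y < ereal u"
    obtain v where v: "y < ereal v" "ereal v < ereal u" using ereal_dense2[OF y] by blast
    \<comment> \<open>The maximum with u / 2 makes the exponent positive, as \<open>lower\<close>
      demands, and keeps it below \<open>u\<close>.\<close>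
    have "ereal v \<le> ereal (max v (u / 2))" by simp
    also have "\<dots> \<le> Sup {ereal v | v. A v}"
    proof (rule Sup_upper)
      have "A (max v (u / 2))" using v u by (intro lower) auto
      then show "ereal (max v (u / 2)) \<in> {ereal v | v. A v}" by blast
    qed
    finally show "y \<le> Sup {ereal v | v. A v}" using v by order
  qed
qed

section \<open>Exponents from a sequence of quadratic approximations\<close>

text \<open>One constant \<open>K\<close> serves all comparisons. \<open>F_lower\<close> and
  \<open>F_upper\<close> say that \<open>F j\<close> has slope of order 1 between
  \<open>\<alpha> j\<close> and \<xi>; \<open>liouville\<close> is the norm bound in the quadratic
  field, uniform in \<open>j\<close> and \<open>P\<close>.\<close>

locale quadratic_approximations =
  fixes \<xi> w K :: real and \<alpha> T :: "nat \<Rightarrow> real" and F :: "nat \<Rightarrow> int poly"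
  assumes w_pos: "w > 0" and K_ge_1: "K \<ge> 1"
    and xi_bound: "\<bar>\<xi>\<bar> \<le> 1" and alpha_bound: "\<bar>\<alpha> j\<bar> \<le> 1"
    and T_ge_1: "T j \<ge> 1" and T_at_top: "filterlim T at_top sequentially"
    and growth: "\<epsilon> > 0 \<Longrightarrow> \<exists>C. \<forall>j. \<bar>ln (T (Suc j)) - w * ln (T j)\<bar> \<le> \<epsilon> * ln (T j) + C"
    and min_poly: "is_int_min_poly (\<alpha> j) (F j)" and degree_F: "degree (F j) = 2"
    and lead_F: "T j \<le> K * of_int (lead_coeff (F j))"
    and coeff_F: "\<bar>of_int (coeff (F j) i)\<bar> \<le> K * T j"
    and dist_lower: "1 \<le> K * T (Suc j) * \<bar>\<xi> - \<alpha> j\<bar>"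
    and dist_upper: "T (Suc j) * \<bar>\<xi> - \<alpha> j\<bar> \<le> K"
    and F_lower: "\<bar>\<xi> - \<alpha> j\<bar> \<le> K * \<bar>rpoly (F j) \<xi>\<bar>"
    and F_upper: "\<bar>rpoly (F j) \<xi>\<bar> \<le> K * \<bar>\<xi> - \<alpha> j\<bar>"
    and liouville: "\<exists>c>0. \<forall>j P. degree P \<le> n \<longrightarrow> rpoly P (\<alpha> j) \<noteq> 0 \<longrightarrow>
          c \<le> \<bar>rpoly P (\<alpha> j)\<bar> * of_int (poly_height P) * T j ^ n"
begin

section \<open>Lower bounds for |P(\<xi>)| and for the distance from \<xi> to algebraic
  numbers\<close>

lemma ln_T_nonneg: "ln (T j) \<ge> 0"
  using T_ge_1[of j] by simp

lemma ln_T_at_top: "filterlim (\<lambda>j. ln (T j)) at_top sequentially"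
  by (rule filterlim_compose[OF ln_at_top T_at_top])

lemma w_ge_2:
  assumes n: "real n < w" and quad: "2 * real n * w \<le> (w - 2) * (w - real n)"
  shows "w \<ge> 2"
proof (rule ccontr)
  assume "\<not> w \<ge> 2"
  then have "(w - 2) * (w - real n) < 0" using n by (intro mult_neg_pos) auto
  moreover have "2 * real n * w \<ge> 0" using w_pos by simp
  ultimately show False using quad by linarith
qed

text \<open>The index \<open>j\<close> used for \<open>P\<close> varies with its height, so all
  \<open>\<alpha> j\<close> are excluded as roots. It is the first one at which the norm bound for
  P(\<open>\<alpha> j\<close>) outweighs the Lipschitz error; the failure at j - 1 bounds
  \<open>T j\<close> by a power of the height.\<close>

lemma rpoly_lower_bound_or_root:
  assumes n: "real n < w" and quad: "2 * real n * w \<le> (w - 2) * (w - real n)" and \<eta>: "\<eta> > 0"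
  obtains c where "c > 0" "\<And>P. P \<noteq> 0 \<Longrightarrow> degree P \<le> n \<Longrightarrow> (\<And>j. rpoly P (\<alpha> j) \<noteq> 0) \<Longrightarrow>
    c * of_int (poly_height P) powr - (w - 1 + \<eta>) \<le> \<bar>rpoly P \<xi>\<bar>"
proof -
  define L where "L = real (Suc n) * real n * 2 ^ n + 1"
  have L: "L \<ge> 1" by (simp add: L_def)
  obtain c where c: "c > 0" "\<And>j P. degree P \<le> n \<Longrightarrow> rpoly P (\<alpha> j) \<noteq> 0 \<Longrightarrow>
      c \<le> \<bar>rpoly P (\<alpha> j)\<bar> * of_int (poly_height P) * T j ^ n"
    using liouville[of n] by blast
  have w2: "w \<ge> 2" by (rule w_ge_2) fact+
  \<comment> \<open>The first entry keeps \<delta> above n; the second lets the slack \<eta> (w - n)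
    pay for replacing w by \<delta> in the quadratic inequality.\<close>
  define \<epsilon> where "\<epsilon> = min ((w - n) / 2) (\<eta> * (w - n) / (w - 2 + \<eta>))"
  define \<delta> where "\<delta> = w - \<epsilon>"
  have \<epsilon>: "\<epsilon> > 0" "\<epsilon> \<le> (w - n) / 2" "\<epsilon> * (w - 2 + \<eta>) \<le> \<eta> * (w - n)"
  proof -
    show "\<epsilon> > 0" using n \<eta> w2 by (simp add: \<epsilon>_def)
    show "\<epsilon> \<le> (w - n) / 2" unfolding \<epsilon>_def by (rule min.cobounded1)
    have "\<epsilon> \<le> \<eta> * (w - n) / (w - 2 + \<eta>)" unfolding \<epsilon>_def by (rule min.cobounded2)
    then show "\<epsilon> * (w - 2 + \<eta>) \<le> \<eta> * (w - n)" using w2 \<eta> by (simp add: pos_le_divide_eq)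
  qed
  have \<delta>: "\<delta> > n" "2 * real n * \<delta> \<le> (w - 2 + \<eta>) * (\<delta> - n)"
  proof -
    show "\<delta> > n" using \<epsilon> n by (simp add: \<delta>_def field_simps)
    have "0 \<le> real n * \<epsilon>" using \<epsilon> by simp
    moreover have "(w - 2 + \<eta>) * (\<delta> - n) = (w - 2) * (w - n) + \<eta> * (w - n) - \<epsilon> * (w - 2 + \<eta>)"
      by (simp add: \<delta>_def algebra_simps)
    ultimately show "2 * real n * \<delta> \<le> (w - 2 + \<eta>) * (\<delta> - n)"
      using quad \<epsilon>(3) by (simp add: \<delta>_def algebra_simps)
  qed
  obtain C0 where C0: "\<And>j. \<bar>ln (T (Suc j)) - w * ln (T j)\<bar> \<le> \<epsilon> * ln (T j) + C0"
    using growth[OF \<epsilon>(1)] by blast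
  define C where "C = \<bar>C0\<bar>"
  have C: "ln (T (Suc j)) \<ge> \<delta> * ln (T j) - C" "C \<ge> 0" for j
    using C0[of j] by (auto simp: \<delta>_def C_def algebra_simps abs_if split: if_splits)
  define D where "D = \<bar>ln (2 * L * K / c)\<bar>"
  have D: "D \<ge> 0" "2 * L * K / c \<le> exp D"
  proof -
    show "D \<ge> 0" by (simp add: D_def)
    have "2 * L * K / c = exp (ln (2 * L * K / c))" using L K_ge_1 c by simp
    also have "\<dots> \<le> exp D" by (simp add: D_def)
    finally show "2 * L * K / c \<le> exp D" .
  qed
  \<comment> \<open>Collects what does not depend on the height: the initial value
    \<open>T 0\<close> for the case j = 0, and the additive constants of the recursion for j >
    0.\<close>
  define E where "E = n * (ln (T 0) + (\<delta> * D + n * C) / (\<delta> - n))"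
  show ?thesis
  proof (rule that)
    show "c / 2 * exp (- E) > 0" using c by simp
    fix P :: "int poly"
    assume P: "P \<noteq> 0" "degree P \<le> n" "\<And>j. rpoly P (\<alpha> j) \<noteq> 0"
    define H where "H = real_of_int (poly_height P)"
    have H: "H \<ge> 1" using poly_height_ge_1[OF P(1)] by (simp add: H_def)
    define h where "h = ln H"
    have h: "h \<ge> 0" "H = exp h" using H by (auto simp: h_def)
    \<comment> \<open>In logarithms: \<open>T (Suc j)\<close> is at least exp D times H^2 T_j^n,
      where exp D dominates 2 L K / c.\<close>
    define good where "good = (\<lambda>j. D + 2 * h + n * ln (T j) \<le> ln (T (Suc j)))"
    \<comment> \<open>Since \<delta> > n, the lower half of \<open>growth\<close> makes every
      \<open>j\<close> with large enough \<open>T j\<close> good.\<close>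
    have "eventually (\<lambda>j. (D + 2 * h + C) / (\<delta> - n) \<le> ln (T j)) sequentially"
      using ln_T_at_top by (simp add: filterlim_at_top)
    then obtain j0 where "(D + 2 * h + C) / (\<delta> - n) \<le> ln (T j0)"
      using eventually_happens by fastforce
    then have "D + 2 * h + C \<le> (\<delta> - n) * ln (T j0)"
      using \<delta> by (simp add: field_simps)
    then have "good j0" using C(1)[of j0] by (simp add: good_def algebra_simps)
    define j where "j = (LEAST j. good j)"
    have j: "good j" unfolding j_def using \<open>good j0\<close> by (rule LeastI)
    have j_min: "\<not> good i" if "i < j" for i
      using that unfolding j_def by (rule not_less_Least)
    have Tj: "n * ln (T j) \<le> E + (w - 2 + \<eta>) * h"
    proof (cases j)
      case 0
      have "0 \<le> n * ((\<delta> * D + n * C) / (\<delta> - n)) + (w - 2 + \<eta>) * h"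
        using \<delta> C(2) D w2 \<eta> h by (intro add_nonneg_nonneg mult_nonneg_nonneg divide_nonneg_pos) auto
      then show ?thesis by (simp add: 0 E_def algebra_simps)
    next
      case (Suc i)
      let ?t = "ln (T j)"
      \<comment> \<open>Goodness fails at i = j - 1; eliminating \<open>T i\<close> between this and
        \<open>growth\<close> bounds \<open>T j\<close> in terms of the height alone.\<close>
      have "?t \<le> D + 2 * h + n * ln (T i)" using j_min[of i] Suc by (simp add: good_def)
      then have 1: "\<delta> * ?t \<le> \<delta> * (D + 2 * h) + n * (\<delta> * ln (T i))"
        using \<delta>(1) mult_left_mono[of ?t "D + 2 * h + n * ln (T i)" \<delta>] by (simp add: algebra_simps)
      have "n * (\<delta> * ln (T i)) \<le> n * (?t + C)"
        using C(1)[of i] Suc by (intro mult_left_mono) auto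
      with 1 have "(\<delta> - n) * ?t \<le> (\<delta> * D + n * C) + 2 * \<delta> * h"
        by (simp add: algebra_simps)
      then have "?t \<le> ((\<delta> * D + n * C) + 2 * \<delta> * h) / (\<delta> - n)"
        using \<delta>(1) by (simp add: field_simps)
      then have "n * ?t \<le> n * (((\<delta> * D + n * C) + 2 * \<delta> * h) / (\<delta> - n))"
        by (intro mult_left_mono) auto
      also have "\<dots> = n * ((\<delta> * D + n * C) / (\<delta> - n)) + (2 * n * \<delta>) / (\<delta> - n) * h"
        by (simp add: add_divide_distrib algebra_simps)
      \<comment> \<open>This is where the hypothesis relating n and w enters.\<close>
      also have "(2 * n * \<delta>) / (\<delta> - n) * h \<le> (w - 2 + \<eta>) * h"
        using \<delta> h by (intro mult_right_mono) (auto simp: pos_divide_le_eq)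
      also have "n * ((\<delta> * D + n * C) / (\<delta> - n)) \<le> E"
        using ln_T_nonneg[of 0] by (simp add: E_def distrib_left)
      finally show ?thesis by linarith
    qed
    have T0: "T i > 0" for i using T_ge_1[of i] by linarith
    have Texp: "exp (n * ln (T j)) = T j ^ n"
      unfolding exp_of_nat_mult using T0[of j] by simp
    have "2 * L * K / c * (H\<^sup>2 * T j ^ n) \<le> exp D * (H\<^sup>2 * T j ^ n)"
      using D(2) T0[of j] by (intro mult_right_mono) auto
    also have "H\<^sup>2 = exp (2 * h)" unfolding h(2) power2_eq_square mult_2 exp_add ..
    also have "exp D * (exp (2 * h) * T j ^ n) = exp (D + 2 * h + n * ln (T j))"
      unfolding Texp[symmetric] exp_add by (rule mult.assoc[symmetric])
    also have "\<dots> \<le> exp (ln (T (Suc j)))" using j by (simp add: good_def)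
    also have "\<dots> = T (Suc j)" using T0 by simp
    finally have "2 * L * K / c * (H\<^sup>2 * T j ^ n) \<le> T (Suc j)"
      unfolding h(2) power2_eq_square mult_2 exp_add .
    then have big: "2 * L * K * H\<^sup>2 * T j ^ n \<le> c * T (Suc j)"
      using c(1) by (simp add: field_simps)
    have lip: "\<bar>rpoly P \<xi> - rpoly P (\<alpha> j)\<bar> \<le> L * H * \<bar>\<xi> - \<alpha> j\<bar>"
    proof -
      have "\<bar>rpoly P \<xi> - rpoly P (\<alpha> j)\<bar> \<le> (L - 1) * H * \<bar>\<xi> - \<alpha> j\<bar>"
      proof -
        have "\<bar>\<xi>\<bar> \<le> 2" "\<bar>\<alpha> j\<bar> \<le> 2" using xi_bound alpha_bound[of j] by linarith+
        moreover have "L - 1 = real (Suc n) * real n * 2 ^ n" by (simp add: L_def)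
        ultimately show ?thesis unfolding H_def by (simp only: rpoly_lipschitz[OF P(2)])
      qed
      also have "\<dots> \<le> L * H * \<bar>\<xi> - \<alpha> j\<bar>" using H by (intro mult_right_mono) auto
      finally show ?thesis .
    qed
    have Tn: "T j ^ n > 0" using T0 by simp
    \<comment> \<open>The Lipschitz error is at most half of the lower bound c / (H T_j^n) for
      |P(\<open>\<alpha> j\<close>)|, so the other half remains for |P(\<xi>)|.\<close>
    have "2 * (L * H * \<bar>\<xi> - \<alpha> j\<bar>) * (H * T j ^ n) * T (Suc j)
        = (2 * L * H\<^sup>2 * T j ^ n) * (T (Suc j) * \<bar>\<xi> - \<alpha> j\<bar>)"
      by (simp add: power2_eq_square)
    also have "\<dots> \<le> (2 * L * H\<^sup>2 * T j ^ n) * K"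
      using dist_upper[of j] L Tn by (intro mult_left_mono) auto
    also have "\<dots> \<le> c * T (Suc j)" using big by (simp add: mult_ac)
    finally have "2 * (L * H * \<bar>\<xi> - \<alpha> j\<bar>) * (H * T j ^ n) \<le> c"
      using T0[of "Suc j"] by simp
    moreover have "c \<le> \<bar>rpoly P (\<alpha> j)\<bar> * (H * T j ^ n)"
      using c(2)[OF P(2) P(3)] by (simp add: H_def mult_ac)
    moreover have "\<bar>rpoly P (\<alpha> j)\<bar> * (H * T j ^ n) \<le> (\<bar>rpoly P \<xi>\<bar> + L * H * \<bar>\<xi> - \<alpha> j\<bar>) * (H * T j ^ n)"
      using lip Tn H by (intro mult_right_mono) auto
    ultimately have main: "c / 2 \<le> \<bar>rpoly P \<xi>\<bar> * (H * T j ^ n)"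
      by (simp add: algebra_simps)
    have "H * T j ^ n = exp (h + n * ln (T j))"
      unfolding exp_add Texp h(2) ..
    also have "\<dots> \<le> exp (E + (w - 1 + \<eta>) * h)" using Tj by (simp add: algebra_simps)
    finally have "\<bar>rpoly P \<xi>\<bar> * (H * T j ^ n) \<le> \<bar>rpoly P \<xi>\<bar> * exp (E + (w - 1 + \<eta>) * h)"
      by (intro mult_left_mono) auto
    with main have "c / 2 \<le> \<bar>rpoly P \<xi>\<bar> * exp (E + (w - 1 + \<eta>) * h)" by linarith
    then have "c / 2 * exp (- (E + (w - 1 + \<eta>) * h))
        \<le> \<bar>rpoly P \<xi>\<bar> * exp (E + (w - 1 + \<eta>) * h) * exp (- (E + (w - 1 + \<eta>) * h))"
      by (rule mult_right_mono) simp
    also have "\<dots> = \<bar>rpoly P \<xi>\<bar>" unfolding mult.assoc exp_minus_inverse by simp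
    finally have "c / 2 * exp (- (E + (w - 1 + \<eta>) * h)) \<le> \<bar>rpoly P \<xi>\<bar>" .
    moreover have "exp (- (E + (w - 1 + \<eta>) * h)) = exp (- E) * H powr - (w - 1 + \<eta>)"
      using H by (simp add: powr_def h_def algebra_simps flip: exp_add)
    ultimately show "c / 2 * exp (- E) * of_int (poly_height P) powr - (w - 1 + \<eta>) \<le> \<bar>rpoly P \<xi>\<bar>"
      by (simp add: H_def mult_ac)
  qed
qed

text \<open>The upper half of \<open>growth\<close>, exponentiated; with \<open>dist_lower\<close>
  and \<open>F_lower\<close> it bounds the approximations from below by powers of
  \<open>T j\<close>.\<close>

lemma inverse_T_Suc_lower_bound:
  assumes "\<eta> > 0"
  obtains c where "c > 0" "\<And>j. c * T j powr - (w + \<eta>) \<le> 1 / T (Suc j)"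
proof -
  obtain C where C: "\<And>j. \<bar>ln (T (Suc j)) - w * ln (T j)\<bar> \<le> \<eta> * ln (T j) + C"
    using growth[OF assms] by blast
  have "exp (- C) * T j powr - (w + \<eta>) \<le> 1 / T (Suc j)" for j
  proof -
    have "exp (- C) * T j powr - (w + \<eta>) = exp (- (C + (w + \<eta>) * ln (T j)))"
      using T_ge_1[of j] by (simp add: powr_def algebra_simps flip: exp_add)
    also have "\<dots> \<le> exp (- ln (T (Suc j)))"
      using C[of j] by (simp add: algebra_simps)
    also have "\<dots> = 1 / T (Suc j)" using T_ge_1[of "Suc j"] by (simp add: exp_minus field_simps)
    finally show ?thesis .
  qed
  then show ?thesis using that[of "exp (- C)"] by auto
qed

lemma dist_lower': "1 / T (Suc j) \<le> K * \<bar>\<xi> - \<alpha> j\<bar>"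
  using dist_lower[of j] T_ge_1[of "Suc j"] by (simp add: field_simps)

lemma rpoly_F_lower: "1 / T (Suc j) \<le> K\<^sup>2 * \<bar>rpoly (F j) \<xi>\<bar>"
proof -
  have "K * \<bar>\<xi> - \<alpha> j\<bar> \<le> K * (K * \<bar>rpoly (F j) \<xi>\<bar>)"
    using F_lower[of j] K_ge_1 by (intro mult_left_mono) auto
  then show ?thesis using dist_lower'[of j] by (simp add: power2_eq_square)
qed

lemma lead_F_pos: "lead_coeff (F j) > 0"
  using min_poly[of j] by (simp add: is_int_min_poly_def)

lemma T_le_poly_height_F: "T j \<le> K * of_int (poly_height (F j))"
proof -
  have "real_of_int (lead_coeff (F j)) \<le> of_int (poly_height (F j))"
    using abs_coeff_le_poly_height[of "F j" "degree (F j)"] by linarith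
  then have "K * of_int (lead_coeff (F j)) \<le> K * of_int (poly_height (F j))"
    using K_ge_1 by (intro mult_left_mono) auto
  then show ?thesis using lead_F[of j] by linarith
qed

lemma poly_height_F_le: "of_int (poly_height (F j)) \<le> K * T j"
  using poly_height_obtain[of "F j"] coeff_F[of j] by (metis of_int_abs)

lemma factor_F:
  assumes "rpoly P (\<alpha> j) = 0" "P \<noteq> 0"
  obtains R where "P = F j * R" "R \<noteq> 0" "degree P = degree R + 2"
    "T j * of_int (poly_height R) \<le> K * (2 * K\<^sup>2 + 1) ^ Suc (degree R) * of_int (poly_height P)"
proof -
  obtain R where R: "P = F j * R"
    using is_int_min_poly_dvd[OF min_poly assms(1)] by (auto simp: dvd_def)
  have R0: "R \<noteq> 0" "F j \<noteq> 0" using R assms(2) by auto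
  have lc: "of_int \<bar>lead_coeff (F j)\<bar> = real_of_int (lead_coeff (F j))" using lead_F_pos[of j] by simp
  \<comment> \<open>\<open>coeff_F\<close> and \<open>lead_F\<close> together compare every
    coefficient with the leading one, so \<open>quadratic_quotient_height\<close> applies with k =
    K^2.\<close>
  have "\<bar>real_of_int (coeff (F j) i)\<bar> \<le> K\<^sup>2 * of_int \<bar>lead_coeff (F j)\<bar>" for i
  proof -
    have "K * T j \<le> K * (K * of_int (lead_coeff (F j)))"
      using lead_F[of j] K_ge_1 by (intro mult_left_mono) auto
    then show ?thesis using coeff_F[of j i] unfolding lc by (simp add: power2_eq_square)
  qed
  then have *: "of_int \<bar>lead_coeff (F j)\<bar> * of_int (poly_height R)
      \<le> (2 * K\<^sup>2 + 1) ^ Suc (degree R) * real_of_int (poly_height P)"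
    using quadratic_quotient_height[OF degree_F, of j "K\<^sup>2" R "degree R"] R by simp
  have "T j * of_int (poly_height R) \<le> K * of_int (lead_coeff (F j)) * of_int (poly_height R)"
    using lead_F[of j] poly_height_ge_1[OF R0(1)] by (intro mult_right_mono) auto
  also have "\<dots> \<le> K * ((2 * K\<^sup>2 + 1) ^ Suc (degree R) * of_int (poly_height P))"
    using * K_ge_1 unfolding lc mult.assoc by (intro mult_left_mono) auto
  finally have "T j * of_int (poly_height R) \<le> K * (2 * K\<^sup>2 + 1) ^ Suc (degree R) * of_int (poly_height P)"
    by (simp only: mult.assoc)
  moreover have "degree P = degree R + 2" using R R0 by (simp add: degree_mult_eq degree_F)
  ultimately show ?thesis using that R R0 by blast
qed

text \<open>When \<open>P = F j * R\<close>, the height of \<open>P\<close> is at least a constant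
  times \<open>T j\<close> times that of \<open>R\<close>, so the bounds for \<open>F j\<close> and
  \<open>R\<close>, having the same exponent, multiply. The bound \<open>m\<close> carries the
  induction while \<open>n\<close> stays fixed in \<open>quad\<close>.\<close>

lemma rpoly_lower_bound:
  assumes n: "real n < w" and quad: "2 * real n * w \<le> (w - 2) * (w - real n)" and \<eta>: "\<eta> > 0"
  shows "\<exists>c>0. \<forall>P. P \<noteq> 0 \<longrightarrow> degree P \<le> n \<longrightarrow> degree P \<le> m \<longrightarrow>
    c * of_int (poly_height P) powr - (w + \<eta>) \<le> \<bar>rpoly P \<xi>\<bar>"
proof -
  obtain c0 where c0: "c0 > 0" "\<And>P. P \<noteq> 0 \<Longrightarrow> degree P \<le> n \<Longrightarrow> (\<And>j. rpoly P (\<alpha> j) \<noteq> 0) \<Longrightarrow>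
    c0 * of_int (poly_height P) powr - (w - 1 + \<eta>) \<le> \<bar>rpoly P \<xi>\<bar>"
    using rpoly_lower_bound_or_root[OF assms] by metis
  have nonroot: "c0 * of_int (poly_height P) powr - (w + \<eta>) \<le> \<bar>rpoly P \<xi>\<bar>"
    if P: "P \<noteq> 0" "degree P \<le> n" "\<And>j. rpoly P (\<alpha> j) \<noteq> 0" for P
  proof -
    have "of_int (poly_height P) powr - (w + \<eta>) \<le> real_of_int (poly_height P) powr - (w - 1 + \<eta>)"
      using poly_height_ge_1[OF P(1)] by (intro powr_mono) auto
    then show ?thesis using c0(2)[OF P] c0(1) by (smt (verit) mult_left_mono)
  qed
  obtain c1 where c1: "c1 > 0" "\<And>j. c1 * T j powr - (w + \<eta>) \<le> 1 / T (Suc j)"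
    using inverse_T_Suc_lower_bound[OF \<eta>] by metis
  show ?thesis
  proof (induction m)
    case 0
    \<comment> \<open>A nonzero constant cannot have the quadratic factor
      \<open>F j\<close>.\<close>
    have "rpoly P (\<alpha> j) \<noteq> 0" if "P \<noteq> 0" "degree P \<le> 0" for P j
      using factor_F[of P j] that by (metis add_is_0 le_zero_eq zero_neq_numeral)
    then show ?case using nonroot c0(1) by blast
  next
    case (Suc m)
    then obtain c where c: "c > 0" "\<And>P. P \<noteq> 0 \<Longrightarrow> degree P \<le> n \<Longrightarrow> degree P \<le> m \<Longrightarrow>
      c * of_int (poly_height P) powr - (w + \<eta>) \<le> \<bar>rpoly P \<xi>\<bar>" by blast
    define D where "D = K * (2 * K\<^sup>2 + 1) ^ Suc m"
    have D: "D > 0" using K_ge_1 by (simp add: D_def add_pos_pos)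
    \<comment> \<open>The product of the constants for \<open>F j\<close>, for the cofactor
      \<open>R\<close>, and for the comparison of \<open>T j\<close> times the height of
      \<open>R\<close> with the height of \<open>P\<close>.\<close>
    define c' where "c' = c1 / K\<^sup>2 * c * D powr - (w + \<eta>)"
    have c': "c' > 0" using c1 c K_ge_1 D by (simp add: c'_def)
    have "min c0 c' * of_int (poly_height P) powr - (w + \<eta>) \<le> \<bar>rpoly P \<xi>\<bar>"
      if P: "P \<noteq> 0" "degree P \<le> n" "degree P \<le> Suc m" for P
    proof (cases "\<exists>j. rpoly P (\<alpha> j) = 0")
      case False
      then have "c0 * of_int (poly_height P) powr - (w + \<eta>) \<le> \<bar>rpoly P \<xi>\<bar>"
        using P by (intro nonroot) auto
      moreover have "min c0 c' * real_of_int (poly_height P) powr - (w + \<eta>) \<le> c0 * of_int (poly_height P) powr - (w + \<eta>)"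
        by (intro mult_right_mono) auto
      ultimately show ?thesis by linarith
    next
      case True
      then obtain j where "rpoly P (\<alpha> j) = 0" by blast
      then obtain R where R: "P = F j * R" "R \<noteq> 0" "degree P = degree R + 2"
        "T j * of_int (poly_height R) \<le> K * (2 * K\<^sup>2 + 1) ^ Suc (degree R) * of_int (poly_height P)"
        using factor_F P(1) by metis
      let ?HR = "real_of_int (poly_height R)" and ?HP = "real_of_int (poly_height P)"
      have HR: "?HR \<ge> 1" and HP: "?HP \<ge> 1" using poly_height_ge_1 R P by auto
      have "K * (2 * K\<^sup>2 + 1) ^ Suc (degree R) \<le> D"
        unfolding D_def using K_ge_1 R(3) P(3) by (intro mult_left_mono power_increasing) auto
      then have "T j * ?HR \<le> D * ?HP"
        using R(4) HP by (smt (verit) mult_right_mono)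
      then have "(D * ?HP) powr - (w + \<eta>) \<le> (T j * ?HR) powr - (w + \<eta>)"
        using T_ge_1[of j] HR w_pos \<eta> by (intro powr_mono2') auto
      then have hp: "D powr - (w + \<eta>) * ?HP powr - (w + \<eta>) \<le> T j powr - (w + \<eta>) * ?HR powr - (w + \<eta>)"
        using T_ge_1[of j] HR HP D by (simp add: powr_mult)
      have "c1 * T j powr - (w + \<eta>) \<le> K\<^sup>2 * \<bar>rpoly (F j) \<xi>\<bar>"
        using c1(2)[of j] rpoly_F_lower[of j] by linarith
      then have f: "c1 / K\<^sup>2 * T j powr - (w + \<eta>) \<le> \<bar>rpoly (F j) \<xi>\<bar>"
        using K_ge_1 by (simp add: field_simps)
      have r: "c * ?HR powr - (w + \<eta>) \<le> \<bar>rpoly R \<xi>\<bar>"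
        using R(3) P by (intro c(2) R(2)) auto
      have "c' * ?HP powr - (w + \<eta>) = (c1 / K\<^sup>2 * c) * (D powr - (w + \<eta>) * ?HP powr - (w + \<eta>))"
        by (simp add: c'_def)
      also have "\<dots> \<le> (c1 / K\<^sup>2 * c) * (T j powr - (w + \<eta>) * ?HR powr - (w + \<eta>))"
        using hp c1(1) c(1) by (intro mult_left_mono) auto
      also have "\<dots> = (c1 / K\<^sup>2 * T j powr - (w + \<eta>)) * (c * ?HR powr - (w + \<eta>))"
        by simp
      also have "\<dots> \<le> \<bar>rpoly (F j) \<xi>\<bar> * \<bar>rpoly R \<xi>\<bar>"
        using f r c(1) by (intro mult_mono) auto
      also have "\<dots> = \<bar>rpoly P \<xi>\<bar>" by (simp add: R(1) map_poly_of_int_mult abs_mult)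
      finally have "c' * ?HP powr - (w + \<eta>) \<le> \<bar>rpoly P \<xi>\<bar>" .
      moreover have "min c0 c' * ?HP powr - (w + \<eta>) \<le> c' * ?HP powr - (w + \<eta>)"
        by (intro mult_right_mono) auto
      ultimately show ?thesis by linarith
    qed
    then show ?case using c0(1) c' by (intro exI[of _ "min c0 c'"]) auto
  qed
qed

text \<open>If no \<open>\<alpha> j\<close> is a root of the minimal polynomial of a nearby \<beta>,
  its value at \<xi> is bounded below, and dividing by the Lipschitz constant L H turns the exponent
  w - 1 into w. The roots of \<open>F j\<close> are treated directly: \<open>\<alpha> j\<close> by
  \<open>dist_lower\<close>, its conjugate by \<open>F_lower\<close>.\<close>

lemma algebraic_dist_lower_bound:
  assumes n: "real n < w" and quad: "2 * real n * w \<le> (w - 2) * (w - real n)" and \<eta>: "\<eta> > 0"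
  obtains c where "c > 0" "\<And>\<beta>. algebraic \<beta> \<Longrightarrow> alg_degree \<beta> \<le> n \<Longrightarrow> \<beta> \<noteq> \<xi> \<Longrightarrow>
    c * of_int (alg_height \<beta>) powr - (w + \<eta>) \<le> \<bar>\<xi> - \<beta>\<bar>"
proof -
  obtain c0 where c0: "c0 > 0" "\<And>P. P \<noteq> 0 \<Longrightarrow> degree P \<le> n \<Longrightarrow> (\<And>j. rpoly P (\<alpha> j) \<noteq> 0) \<Longrightarrow>
    c0 * of_int (poly_height P) powr - (w - 1 + \<eta>) \<le> \<bar>rpoly P \<xi>\<bar>"
    using rpoly_lower_bound_or_root[OF assms] by metis
  obtain c1 where c1: "c1 > 0" "\<And>j. c1 * T j powr - (w + \<eta>) \<le> 1 / T (Suc j)"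
    using inverse_T_Suc_lower_bound[OF \<eta>] by metis
  have w2: "w \<ge> 2" by (rule w_ge_2) fact+
  define L where "L = real (Suc n) * real n * 2 ^ n + 1"
  have L: "L \<ge> 1" by (simp add: L_def)
  define k where "k = K powr - (w + \<eta>)"
  have k: "k > 0" using K_ge_1 by (simp add: k_def)
  \<comment> \<open>One entry per case: |\<xi> - \<beta>| \<ge> 1; no \<open>\<alpha> j\<close> is a
    root; \<beta> is \<open>\<alpha> j\<close>; \<beta> is the conjugate of
    \<open>\<alpha> j\<close>.\<close>
  define c where "c = min (min 1 (c0 / L)) (min (c1 * k / K) (1 / K ^ 3))"
  have cpos: "c > 0" using c0(1) c1(1) L k K_ge_1 by (simp add: c_def)
  have c_le: "c \<le> 1" "c \<le> c0 / L" "c \<le> c1 * k / K" "c \<le> 1 / K ^ 3"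
    by (auto simp: c_def)
  have "c * of_int (alg_height \<beta>) powr - (w + \<eta>) \<le> \<bar>\<xi> - \<beta>\<bar>"
    if \<beta>: "algebraic \<beta>" "alg_degree \<beta> \<le> n" "\<beta> \<noteq> \<xi>" for \<beta>
  proof -
    define P where "P = int_min_poly \<beta>"
    have mP: "is_int_min_poly \<beta> P"
      unfolding P_def by (rule is_int_min_poly_int_min_poly) fact
    have P: "P \<noteq> 0" "degree P \<le> n" "rpoly P \<beta> = 0"
      using mP \<beta>(2) by (auto simp: is_int_min_poly_def P_def alg_degree_def)
    define H where "H = real_of_int (poly_height P)"
    have H: "H \<ge> 1" using poly_height_ge_1[OF P(1)] by (simp add: H_def)
    have Hp: "0 < H powr - (w + \<eta>)" "H powr - (w + \<eta>) \<le> 1"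
      using H w_pos \<eta> powr_mono[of "- (w + \<eta>)" 0 H] by auto
    have "c * H powr - (w + \<eta>) \<le> \<bar>\<xi> - \<beta>\<bar>"
    proof (cases "\<bar>\<xi> - \<beta>\<bar> \<ge> 1")
      case True
      have "c * H powr - (w + \<eta>) \<le> 1 * 1"
        using c_le Hp cpos by (intro mult_mono) auto
      then show ?thesis using True by linarith
    next
      case close: False
      show ?thesis
      proof (cases "\<exists>j. rpoly P (\<alpha> j) = 0")
        case False
        then have 1: "c0 * H powr - (w - 1 + \<eta>) \<le> \<bar>rpoly P \<xi>\<bar>"
          using c0(2)[of P] P by (simp add: H_def)
        have "\<bar>rpoly P \<xi>\<bar> \<le> (L - 1) * H * \<bar>\<xi> - \<beta>\<bar>"
          using rpoly_lipschitz[OF P(2), of \<xi> \<beta>] P(3) xi_bound close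
          by (simp add: L_def H_def)
        also have "\<dots> \<le> L * H * \<bar>\<xi> - \<beta>\<bar>" using H by (intro mult_right_mono) auto
        finally have "c0 * H powr - (w - 1 + \<eta>) \<le> L * H * \<bar>\<xi> - \<beta>\<bar>" using 1 by linarith
        moreover have "H powr - (w - 1 + \<eta>) = H powr - (w + \<eta>) * H"
          using H powr_add[of H "- (w + \<eta>)" 1] by (simp add: algebra_simps)
        ultimately have "H * (c0 * H powr - (w + \<eta>)) \<le> H * (L * \<bar>\<xi> - \<beta>\<bar>)"
          by (simp add: mult_ac)
        then have "c0 * H powr - (w + \<eta>) \<le> L * \<bar>\<xi> - \<beta>\<bar>" using H by simp
        then have "c0 / L * H powr - (w + \<eta>) \<le> \<bar>\<xi> - \<beta>\<bar>" using L by (simp add: field_simps)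
        moreover have "c * H powr - (w + \<eta>) \<le> c0 / L * H powr - (w + \<eta>)"
          using c_le Hp by (intro mult_right_mono) auto
        ultimately show ?thesis by linarith
      next
        case True
        then obtain j where "rpoly P (\<alpha> j) = 0" by blast
        then obtain R where R: "P = F j * R" "R \<noteq> 0" "degree P = degree R + 2"
          using factor_F P(1) by metis
        have min_deg: "\<And>Q. Q \<noteq> 0 \<Longrightarrow> rpoly Q \<beta> = 0 \<Longrightarrow> degree P \<le> degree Q"
          using mP by (auto simp: is_int_min_poly_def)
        \<comment> \<open>The cofactor \<open>R\<close> has smaller degree than the minimal
          polynomial \<open>P\<close> and cannot vanish at \<beta>, so \<open>F j\<close> does;
          equal degrees and the common normalisation then give \<open>P = F j\<close>.\<close>
        have "rpoly (F j) \<beta> * rpoly R \<beta> = 0"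
          using P(3) by (simp add: R(1) map_poly_of_int_mult)
        then have F\<beta>: "rpoly (F j) \<beta> = 0" using min_deg[OF R(2)] R(3) by auto
        have "F j \<noteq> 0" using degree_F[of j] by auto
        then have "degree P = 2" using min_deg[OF _ F\<beta>] R(3) degree_F[of j] by auto
        then have "is_int_min_poly \<beta> (F j)"
          using mP F\<beta> min_poly[of j] degree_F[of j] by (auto simp: is_int_min_poly_def)
        then have PF: "P = F j" using is_int_min_poly_unique mP by blast
        have TK: "T j / K \<le> H" and HK: "H \<le> K * T j"
          using T_le_poly_height_F[of j] poly_height_F_le[of j] K_ge_1
          by (auto simp: PF H_def field_simps)
        show ?thesis
        proof (cases "\<beta> = \<alpha> j")
          case True
          have "T j \<le> K * H" using TK K_ge_1 by (simp add: field_simps)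
          then have "(K * H) powr - (w + \<eta>) \<le> T j powr - (w + \<eta>)"
            using T_ge_1[of j] w_pos \<eta> by (intro powr_mono2') auto
          then have "k * H powr - (w + \<eta>) \<le> T j powr - (w + \<eta>)"
            using K_ge_1 H by (simp add: powr_mult k_def)
          then have "c1 * (k * H powr - (w + \<eta>)) \<le> c1 * T j powr - (w + \<eta>)"
            using c1(1) by (intro mult_left_mono) auto
          also have "\<dots> \<le> K * \<bar>\<xi> - \<beta>\<bar>"
            using c1(2)[of j] dist_lower'[of j] True by simp
          finally have "c1 * k / K * H powr - (w + \<eta>) \<le> \<bar>\<xi> - \<beta>\<bar>"
            using K_ge_1 by (simp add: field_simps)
          moreover have "c * H powr - (w + \<eta>) \<le> c1 * k / K * H powr - (w + \<eta>)"
            using c_le Hp by (intro mult_right_mono) auto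
          ultimately show ?thesis by linarith
        next
          case False
          define A where "A = real_of_int (coeff (F j) 2)"
          define B where "B = real_of_int (coeff (F j) 1)"
          define C where "C = real_of_int (coeff (F j) 0)"
          have ev: "rpoly (F j) x = A * x\<^sup>2 + B * x + C" for x
            using rpoly_as_sum[of "F j" 2 x] degree_F[of j]
            by (simp add: A_def B_def C_def numeral_2_eq_2)
          have "rpoly (F j) (\<alpha> j) = 0" using min_poly[of j] by (simp add: is_int_min_poly_def)
          then have e1: "A * (\<alpha> j)\<^sup>2 + B * \<alpha> j + C = 0" by (simp add: ev)
          have e2: "A * \<beta>\<^sup>2 + B * \<beta> + C = 0" using F\<beta> by (simp add: ev)
          \<comment> \<open>Vieta's formulas for the distinct roots \<open>\<alpha> j\<close> and
            \<beta>, by subtracting the two equations. Factoring \<open>F j\<close> at \<xi> and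
            cancelling |\<xi> - \<open>\<alpha> j\<close>| in \<open>F_lower\<close> then bounds
            |\<xi> - \<beta>| below by 1 / (K |A|).\<close>
          have "(\<beta> - \<alpha> j) * (A * (\<beta> + \<alpha> j) + B) = 0" using e1 e2 by algebra
          then have B: "B = - (A * (\<beta> + \<alpha> j))" using False by simp
          have C: "C = A * \<beta> * \<alpha> j" using e1 B by algebra
          have "rpoly (F j) \<xi> = A * (\<xi> - \<alpha> j) * (\<xi> - \<beta>)"
            unfolding ev B C by algebra
          then have "\<bar>\<xi> - \<alpha> j\<bar> \<le> K * (\<bar>A\<bar> * \<bar>\<xi> - \<alpha> j\<bar> * \<bar>\<xi> - \<beta>\<bar>)"
            using F_lower[of j] by (simp add: abs_mult)
          then have "\<bar>\<xi> - \<alpha> j\<bar> * 1 \<le> \<bar>\<xi> - \<alpha> j\<bar> * (K * \<bar>A\<bar> * \<bar>\<xi> - \<beta>\<bar>)"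
            by (simp add: mult_ac)
          moreover have "\<bar>\<xi> - \<alpha> j\<bar> > 0" using dist_lower[of j] by (cases "\<xi> = \<alpha> j") auto
          ultimately have 1: "1 \<le> K * \<bar>A\<bar> * \<bar>\<xi> - \<beta>\<bar>" using mult_le_cancel_left_pos by blast
          have "\<bar>A\<bar> \<le> K * (K * H)"
          proof -
            have "\<bar>A\<bar> \<le> K * T j" using coeff_F[of j 2] by (simp add: A_def)
            also have "\<dots> \<le> K * (K * H)" using TK K_ge_1 by (intro mult_left_mono) (auto simp: field_simps)
            finally show ?thesis .
          qed
          then have "K * \<bar>A\<bar> * \<bar>\<xi> - \<beta>\<bar> \<le> K * (K * (K * H)) * \<bar>\<xi> - \<beta>\<bar>"
            using K_ge_1 by (intro mult_right_mono mult_left_mono) auto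
          then have "1 \<le> K ^ 3 * H * \<bar>\<xi> - \<beta>\<bar>" using 1 by (simp add: power3_eq_cube mult_ac)
          then have "1 / K ^ 3 * (1 / H) \<le> \<bar>\<xi> - \<beta>\<bar>" using K_ge_1 H by (simp add: field_simps)
          moreover have "H powr - (w + \<eta>) \<le> H powr - 1"
            using H w2 \<eta> by (intro powr_mono) auto
          then have "H powr - (w + \<eta>) \<le> 1 / H" using H by (simp add: powr_minus_divide)
          then have "c * H powr - (w + \<eta>) \<le> 1 / K ^ 3 * (1 / H)"
            using c_le Hp K_ge_1 by (intro mult_mono) auto
          ultimately show ?thesis by linarith
        qed
      qed
    qed
    then show ?thesis by (simp add: H_def alg_height_def P_def)
  qed
  then show ?thesis using that cpos by blast
qed

text \<open>Stated for an arbitrary \<open>x\<close> to serve both |F_j(\<xi>)| and |\<xi> -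
  \<open>\<alpha> j\<close>|, which are at most K^2 / \<open>T (Suc j)\<close>.\<close>

lemma eventually_le_poly_height_powr:
  assumes v: "0 < v" "v < w"
  shows "eventually (\<lambda>j. \<forall>x>0. x * T (Suc j) \<le> K\<^sup>2 \<longrightarrow> x \<le> of_int (poly_height (F j)) powr - v) sequentially"
proof -
  \<comment> \<open>With w = v + 2 \<epsilon>, one \<epsilon> is lost in \<open>growth\<close> and
    the other absorbs the constants once \<open>ln (T j)\<close> is large.\<close>
  define \<epsilon> where "\<epsilon> = (w - v) / 2"
  have \<epsilon>: "\<epsilon> > 0" using v by (simp add: \<epsilon>_def)
  obtain C where C: "\<And>j. \<bar>ln (T (Suc j)) - w * ln (T j)\<bar> \<le> \<epsilon> * ln (T j) + C"
    using growth[OF \<epsilon>] by blast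
  have "eventually (\<lambda>j. (ln (K\<^sup>2) + C + v * ln K) / \<epsilon> \<le> ln (T j)) sequentially"
    using ln_T_at_top by (simp add: filterlim_at_top)
  then show ?thesis
  proof (rule eventually_mono, intro allI impI)
    fix j and x :: real
    assume j: "(ln (K\<^sup>2) + C + v * ln K) / \<epsilon> \<le> ln (T j)" and x: "x > 0" "x * T (Suc j) \<le> K\<^sup>2"
    have T0: "T i > 0" for i using T_ge_1[of i] by linarith
    let ?H = "real_of_int (poly_height (F j))"
    have "F j \<noteq> 0" using degree_F[of j] by auto
    then have H: "?H \<ge> 1" using poly_height_ge_1 by simp
    have "ln (x * T (Suc j)) \<le> ln (K\<^sup>2)" using x T0[of "Suc j"] K_ge_1 by simp
    then have 1: "ln x \<le> ln (K\<^sup>2) - ln (T (Suc j))" using x T0[of "Suc j"] by (simp add: ln_mult)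
    have "ln ?H \<le> ln (K * T j)" using poly_height_F_le[of j] H T0[of j] K_ge_1 by simp
    then have "ln ?H \<le> ln K + ln (T j)" using K_ge_1 T0[of j] by (simp add: ln_mult)
    then have 2: "v * ln ?H \<le> v * ln K + v * ln (T j)"
      using v mult_left_mono[of "ln ?H" "ln K + ln (T j)" v] by (simp add: distrib_left)
    have 3: "ln (K\<^sup>2) + C + v * ln K \<le> \<epsilon> * ln (T j)" using j \<epsilon> by (simp add: field_simps)
    have "w * ln (T j) = v * ln (T j) + 2 * (\<epsilon> * ln (T j))" by (simp add: \<epsilon>_def field_simps)
    then have "ln x \<le> - v * ln ?H" using 1 2 3 C[of j] by (simp add: abs_if split: if_splits)
    then have "exp (ln x) \<le> exp (- v * ln ?H)" by simp
    then show "x \<le> ?H powr - v" using x H by (simp add: powr_def)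
  qed
qed

text \<open>The heights of the \<open>F j\<close> are unbounded, so a sequence with these heights
  takes infinitely many values. The sequence will be \<open>F\<close> itself or \<alpha>.\<close>

lemma infinite_if_poly_height_F:
  assumes ev: "eventually (\<lambda>j. f j \<in> S) sequentially" and g: "\<And>j. g (f j) = poly_height (F j)"
  shows "infinite S"
proof
  assume "finite S"
  then have "finite (g ` S)" by simp
  then obtain B where B: "\<And>y. y \<in> g ` S \<Longrightarrow> y \<le> B" by (metis bdd_above.E bdd_above_finite)
  have "eventually (\<lambda>j. T j > K * of_int B) sequentially"
    using T_at_top by (simp add: filterlim_at_top_dense)
  with ev have "eventually (\<lambda>j. False) sequentially"
  proof eventually_elim
    case (elim j)
    then have "poly_height (F j) \<le> B" using B g by (metis imageI)
    then have "K * real_of_int (poly_height (F j)) \<le> K * of_int B"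
      using K_ge_1 by (intro mult_left_mono) auto
    then show ?case using T_le_poly_height_F[of j] elim by linarith
  qed
  then show False by simp
qed

section \<open>The values of both exponents at \<xi>\<close>

lemma w_exp_eq:
  assumes n: "2 \<le> n" "real n < w" and quad: "2 * real n * w \<le> (w - 2) * (w - real n)"
  shows "w_exp n \<xi> = ereal w"
  unfolding w_exp_def
proof (rule Sup_ereal_eqI)
  let ?S = "\<lambda>v. {P :: int poly. degree P \<le> n \<and> 0 < \<bar>rpoly P \<xi>\<bar> \<and>
       \<bar>rpoly P \<xi>\<bar> \<le> of_int (poly_height P) powr (- v)}"
  show "w > 0" by (rule w_pos)
  fix v :: real
  show "infinite (?S v)" if v: "0 < v" "v < w"
  proof (rule infinite_if_poly_height_F[where g = poly_height])
    show "eventually (\<lambda>j. F j \<in> ?S v) sequentially"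
      using eventually_le_poly_height_powr[OF v]
    proof eventually_elim
      case (elim j)
      have T0: "T (Suc j) > 0" using T_ge_1[of "Suc j"] by linarith
      have "0 < 1 / T (Suc j)" using T0 by simp
      then have pos: "\<bar>rpoly (F j) \<xi>\<bar> > 0" using rpoly_F_lower[of j] by (cases "rpoly (F j) \<xi> = 0") auto
      have "\<bar>rpoly (F j) \<xi>\<bar> * T (Suc j) \<le> K * \<bar>\<xi> - \<alpha> j\<bar> * T (Suc j)"
        using F_upper[of j] T0 by (intro mult_right_mono) auto
      also have "\<dots> \<le> K * K"
        using mult_left_mono[OF dist_upper[of j], of K] K_ge_1 by (simp add: mult_ac)
      finally have "\<bar>rpoly (F j) \<xi>\<bar> * T (Suc j) \<le> K\<^sup>2" by (simp add: power2_eq_square)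
      then have "\<bar>rpoly (F j) \<xi>\<bar> \<le> of_int (poly_height (F j)) powr - v" using elim pos by blast
      then show ?case using pos n degree_F[of j] by simp
    qed
  qed simp
  show "\<not> infinite (?S v)" if v: "w < v"
  proof -
    \<comment> \<open>Half of the gap as \<eta> keeps w + \<eta> strictly below
      \<open>v\<close>.\<close>
    have \<eta>: "(v - w) / 2 > 0" using v by simp
    obtain c where c: "c > 0" "\<And>P. P \<noteq> 0 \<Longrightarrow> degree P \<le> n \<Longrightarrow>
        c * of_int (poly_height P) powr - (w + (v - w) / 2) \<le> \<bar>rpoly P \<xi>\<bar>"
      using rpoly_lower_bound[OF n(2) quad \<eta>, of n] by auto
    have "finite (?S v)"
    proof (rule finite_polys_if_lower_bound[of c _ "w + (v - w) / 2" "\<lambda>P. \<bar>rpoly P \<xi>\<bar>" n v])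
      fix P assume "P \<in> ?S v"
      then show P: "P \<noteq> 0 \<and> degree P \<le> n \<and> \<bar>rpoly P \<xi>\<bar> \<le> of_int (poly_height P) powr - v" by auto
      show "c * of_int (poly_height P) powr - (w + (v - w) / 2) \<le> \<bar>rpoly P \<xi>\<bar>"
        using P by (intro c(2)) auto
    qed (use c(1) v in \<open>auto simp: field_simps\<close>)
    then show ?thesis by simp
  qed
qed

lemma w_star_exp_eq:
  assumes n: "2 \<le> n" "real n < w" and quad: "2 * real n * w \<le> (w - 2) * (w - real n)"
  shows "w_star_exp n \<xi> = ereal (w - 1)"
  unfolding w_star_exp_def
proof (rule Sup_ereal_eqI)
  let ?S = "\<lambda>v. {\<beta> :: real. algebraic \<beta> \<and> alg_degree \<beta> \<le> n \<and> 0 < \<bar>\<xi> - \<beta>\<bar> \<and>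
       \<bar>\<xi> - \<beta>\<bar> \<le> of_int (alg_height \<beta>) powr (- v - 1)}"
  show "w - 1 > 0" using n by simp
  fix v :: real
  show "infinite (?S v)" if v: "0 < v" "v < w - 1"
  proof (rule infinite_if_poly_height_F[where g = alg_height])
    \<comment> \<open>The additional -1 in the exponent of \<open>w_star_exp\<close> shifts
      \<open>v\<close> to v + 1, to be compared with w.\<close>
    have v1: "0 < v + 1" "v + 1 < w" using v by auto
    show "eventually (\<lambda>j. \<alpha> j \<in> ?S v) sequentially"
      using eventually_le_poly_height_powr[OF v1]
    proof eventually_elim
      case (elim j)
      have pos: "\<bar>\<xi> - \<alpha> j\<bar> > 0" using dist_lower[of j] by (cases "\<xi> = \<alpha> j") auto
      have "K * 1 \<le> K * K" using K_ge_1 by (intro mult_left_mono) auto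
      then have "\<bar>\<xi> - \<alpha> j\<bar> * T (Suc j) \<le> K\<^sup>2"
        using dist_upper[of j] by (simp add: power2_eq_square mult_ac)
      then have "\<bar>\<xi> - \<alpha> j\<bar> \<le> of_int (poly_height (F j)) powr - (v + 1)" using elim pos by blast
      then show ?case
        using pos n degree_F[of j] is_int_min_poly_eq_int_min_poly[OF min_poly[of j]]
        by (simp add: alg_degree_def alg_height_def)
    qed
    show "alg_height (\<alpha> j) = poly_height (F j)" for j
      using is_int_min_poly_eq_int_min_poly[OF min_poly[of j]] by (simp add: alg_height_def)
  qed
  show "\<not> infinite (?S v)" if v: "w - 1 < v"
  proof -
    have \<eta>: "(v + 1 - w) / 2 > 0" using v by simp
    obtain c where c: "c > 0" "\<And>\<beta>. algebraic \<beta> \<Longrightarrow> alg_degree \<beta> \<le> n \<Longrightarrow> \<beta> \<noteq> \<xi> \<Longrightarrow>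
        c * of_int (alg_height \<beta>) powr - (w + (v + 1 - w) / 2) \<le> \<bar>\<xi> - \<beta>\<bar>"
      using algebraic_dist_lower_bound[OF n(2) quad \<eta>] by metis
    \<comment> \<open>Finiteness is proved for the minimal polynomials, each of which has finitely
      many roots; \<open>d P\<close> selects one distance attained at such a root, the
      largest.\<close>
    define d where "d = (\<lambda>P. Max ((\<lambda>\<beta>. \<bar>\<xi> - \<beta>\<bar>) ` {\<beta> \<in> ?S v. int_min_poly \<beta> = P}))"
    have min: "is_int_min_poly \<beta> (int_min_poly \<beta>)" if "\<beta> \<in> ?S v" for \<beta>
      using that is_int_min_poly_int_min_poly by auto
    have fin: "finite {\<beta> \<in> ?S v. int_min_poly \<beta> = P}" for P
    proof (cases "P = 0")
      case True
      have "int_min_poly \<beta> \<noteq> 0" if "\<beta> \<in> ?S v" for \<beta>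
        using min[OF that] by (auto simp: is_int_min_poly_def)
      then have "{\<beta> \<in> ?S v. int_min_poly \<beta> = P} = {}" using True by blast
      then show ?thesis by (simp only: finite.emptyI)
    next
      case False
      have "{\<beta> \<in> ?S v. int_min_poly \<beta> = P} \<subseteq> {\<beta>. rpoly P \<beta> = 0}"
        using min by (auto simp: is_int_min_poly_def)
      moreover have "finite {\<beta>. rpoly P \<beta> = 0}"
        using False by (intro poly_roots_finite) (simp add: map_poly_eq_0_iff)
      ultimately show ?thesis using finite_subset by blast
    qed
    have "finite (int_min_poly ` ?S v)"
    proof (rule finite_polys_if_lower_bound[of c _ "w + (v + 1 - w) / 2" d n "v + 1"])
      fix P assume "P \<in> int_min_poly ` ?S v"
      then have ne: "{\<beta> \<in> ?S v. int_min_poly \<beta> = P} \<noteq> {}" by auto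
      have "d P \<in> (\<lambda>\<beta>. \<bar>\<xi> - \<beta>\<bar>) ` {\<beta> \<in> ?S v. int_min_poly \<beta> = P}"
        unfolding d_def using fin ne by (intro Max_in) auto
      then obtain \<beta> where \<beta>: "\<beta> \<in> ?S v" "int_min_poly \<beta> = P" "d P = \<bar>\<xi> - \<beta>\<bar>" by auto
      show "c * of_int (poly_height P) powr - (w + (v + 1 - w) / 2) \<le> d P"
        using c(2)[of \<beta>] \<beta> by (auto simp: alg_height_def)
      show "P \<noteq> 0 \<and> degree P \<le> n \<and> d P \<le> of_int (poly_height P) powr - (v + 1)"
        using \<beta> min[OF \<beta>(1)] by (auto simp: alg_height_def alg_degree_def is_int_min_poly_def)
    qed (use c(1) v in \<open>auto simp: field_simps\<close>)
    then have "finite (\<Union>P\<in>int_min_poly ` ?S v. {\<beta> \<in> ?S v. int_min_poly \<beta> = P})"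
      using fin by blast
    moreover have "?S v \<subseteq> (\<Union>P\<in>int_min_poly ` ?S v. {\<beta> \<in> ?S v. int_min_poly \<beta> = P})" by blast
    ultimately have "finite (?S v)" using finite_subset by blast
    then show ?thesis by simp
  qed
qed

end

section \<open>Continued fractions\<close>

text \<open>The continued fraction with digits \<open>c 0\<close>, ..., \<open>c (n - 1)\<close>
  continued by a real complete quotient \<open>t\<close>.\<close>

definition cfrac_then :: "(nat \<Rightarrow> int) \<Rightarrow> nat \<Rightarrow> real \<Rightarrow> real" where
  "cfrac_then c n t = foldr (\<lambda>k x. of_int (c k) + 1 / x) [0..<n] t"

lemma cfrac_then_0: "cfrac_then c 0 t = t"
  by (simp add: cfrac_then_def)

lemma cfrac_then_Suc: "cfrac_then c (Suc n) t = cfrac_then c n (of_int (c n) + 1 / t)"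
  by (simp add: cfrac_then_def)

lemma cfrac_then_front: "cfrac_then c (Suc n) t = of_int (c 0) + 1 / cfrac_then (c \<circ> Suc) n t"
proof -
  have "[0..<Suc n] = 0 # map Suc [0..<n]"
    by (simp add: upt_conv_Cons map_Suc_upt del: upt_Suc)
  then show ?thesis by (simp add: cfrac_then_def foldr_map comp_def del: upt_Suc)
qed

lemma finite_cfrac_snoc:
  "finite_cfrac (xs @ [k]) = foldr (\<lambda>c x. of_int c + 1 / x) xs (of_int k)"
proof (induction xs)
  case (Cons x xs)
  obtain y ys where "xs @ [k] = y # ys" by (cases "xs @ [k]") auto
  then show ?case using Cons by simp
qed simp

lemma finite_cfrac_eq_cfrac_then:
  "finite_cfrac (map c [0..<Suc n]) = cfrac_then c n (of_int (c n))"
  by (simp add: finite_cfrac_snoc cfrac_then_def foldr_map comp_def)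

text \<open>The index is shifted by one: \<open>cnum c (Suc n)\<close> over
  \<open>cden c (Suc n)\<close> is the convergent with last digit \<open>c n\<close>, and index 0
  holds the conventional start 1 / 0.\<close>

fun cnum :: "(nat \<Rightarrow> int) \<Rightarrow> nat \<Rightarrow> int" where
  "cnum c 0 = 1"
| "cnum c (Suc 0) = c 0"
| "cnum c (Suc (Suc n)) = c (Suc n) * cnum c (Suc n) + cnum c n"

fun cden :: "(nat \<Rightarrow> int) \<Rightarrow> nat \<Rightarrow> int" where
  "cden c 0 = 0"
| "cden c (Suc 0) = 1"
| "cden c (Suc (Suc n)) = c (Suc n) * cden c (Suc n) + cden c n"

lemma cnum_cden_det: "cnum c (Suc n) * cden c n - cnum c n * cden c (Suc n) = (-1) ^ Suc n"
  by (induction n) (auto simp: algebra_simps)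

locale cfrac_digits =
  fixes c :: "nat \<Rightarrow> int"
  assumes digit_ge_1: "i \<ge> 1 \<Longrightarrow> c i \<ge> 1"
begin

lemma cden_nonneg: "cden c n \<ge> 0"
proof (induction n rule: cden.induct[of "\<lambda>_ n. cden c n \<ge> 0"])
  case (3 _ n)
  then show ?case using digit_ge_1[of "Suc n"] by simp
qed auto

lemma cden_Suc_le: "cden c n \<le> cden c (Suc n)"
proof (induction n rule: cden.induct[of "\<lambda>_ n. cden c n \<le> cden c (Suc n)"])
  case (3 _ n)
  have "1 * cden c (Suc (Suc n)) \<le> c (Suc (Suc n)) * cden c (Suc (Suc n))"
    by (intro mult_right_mono digit_ge_1 cden_nonneg) auto
  then show ?case using cden_nonneg[of "Suc n"] by simp
qed (use digit_ge_1 in auto)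

lemma cden_ge: "cden c (Suc n) \<ge> int n" "cden c (Suc n) \<ge> 1"
proof -
  have pos: "cden c (Suc n) \<ge> 1" for n
    by (induction n) (use cden_Suc_le order_trans in \<open>auto simp del: cden.simps(3)\<close>)
  then show "cden c (Suc n) \<ge> 1" .
  show "cden c (Suc n) \<ge> int n"
  proof (induction n)
    case (Suc n)
    show ?case
    proof (cases n)
      case 0
      then show ?thesis using digit_ge_1[of 1] by simp
    next
      case (Suc k)
      have "1 * cden c (Suc n) \<le> c (Suc n) * cden c (Suc n)"
        by (intro mult_right_mono digit_ge_1 cden_nonneg) auto
      moreover have "cden c n \<ge> 1" using pos Suc by simp
      ultimately show ?thesis using Suc.IH by simp
    qed
  qed simp
qed

lemma cden_pos: "real_of_int (cden c (Suc n)) \<ge> 1" "real_of_int (cden c n) \<ge> 0"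
  using cden_ge(2)[of n] cden_nonneg[of n] by auto

lemma cfrac_then_moebius:
  assumes "t > 0"
  shows "cfrac_then c (Suc n) t =
    (of_int (cnum c (Suc n)) * t + of_int (cnum c n)) / (of_int (cden c (Suc n)) * t + of_int (cden c n))"
  using assms
proof (induction n arbitrary: t)
  case 0
  then show ?case by (simp add: cfrac_then_Suc cfrac_then_0 field_simps)
next
  case (Suc n)
  let ?s = "real_of_int (c (Suc n)) + 1 / t"
  let ?N = "real_of_int (cnum c (Suc n)) * ?s + of_int (cnum c n)"
  let ?D = "real_of_int (cden c (Suc n)) * ?s + of_int (cden c n)"
  have "?s > 0" using digit_ge_1[of "Suc n"] Suc.prems by (simp add: add_pos_pos)
  then have "cfrac_then c (Suc (Suc n)) t = ?N / ?D"
    using Suc.IH by (simp add: cfrac_then_Suc)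
  also have "\<dots> = (?N * t) / (?D * t)" using Suc.prems by simp
  also have "?N * t = of_int (cnum c (Suc (Suc n))) * t + of_int (cnum c (Suc n))"
    using Suc.prems by (simp add: field_simps)
  also have "?D * t = of_int (cden c (Suc (Suc n))) * t + of_int (cden c (Suc n))"
    using Suc.prems by (simp add: field_simps)
  finally show ?case .
qed

text \<open>The Moebius map of \<open>cfrac_then_moebius\<close> has determinant 1 or -1, so the
  difference is given exactly.\<close>

lemma cfrac_then_diff:
  assumes "t > 0" "s > 0"
  shows "\<bar>cfrac_then c (Suc n) t - cfrac_then c (Suc n) s\<bar> = \<bar>t - s\<bar> /
    ((of_int (cden c (Suc n)) * t + of_int (cden c n)) * (of_int (cden c (Suc n)) * s + of_int (cden c n)))"
proof -
  define p p' q q' where "p = real_of_int (cnum c (Suc n))" and "p' = real_of_int (cnum c n)"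
    and "q = real_of_int (cden c (Suc n))" and "q' = real_of_int (cden c n)"
  have q: "q \<ge> 1" "q' \<ge> 0" using cden_pos[of n] by (auto simp: q_def q'_def)
  have pos: "q * t + q' > 0" "q * s + q' > 0"
    using q assms by (auto intro!: add_pos_nonneg)
  have "p * q' - p' * q = real_of_int ((-1) ^ Suc n)"
    unfolding p_def p'_def q_def q'_def cnum_cden_det[of c n, symmetric] by simp
  then have det: "\<bar>p * q' - p' * q\<bar> = 1" by (simp add: power_abs)
  have "(p * t + p') / (q * t + q') - (p * s + p') / (q * s + q')
      = ((p * q' - p' * q) * (t - s)) / ((q * t + q') * (q * s + q'))"
    using pos by (simp add: divide_simps) algebra
  also have "\<bar>\<dots>\<bar> = \<bar>t - s\<bar> / ((q * t + q') * (q * s + q'))"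
    using pos det by (simp add: abs_mult)
  finally show ?thesis
    unfolding cfrac_then_moebius[OF assms(1)] cfrac_then_moebius[OF assms(2)] p_def p'_def q_def q'_def .
qed

section \<open>Convergence and complete quotients\<close>

lemma cfrac_then_ge_1_merge:
  assumes "n \<ge> 1" "u \<ge> 1"
  shows "\<exists>t\<ge>1. cfrac_then c (n + k) u = cfrac_then c n t"
  using assms(2)
proof (induction k arbitrary: u)
  case (Suc k)
  have "real_of_int (c (n + k)) \<ge> 1" using digit_ge_1[of "n + k"] assms(1) by simp
  moreover have "1 / u > 0" using Suc.prems by simp
  ultimately have "of_int (c (n + k)) + 1 / u \<ge> 1" by linarith
  then show ?case using Suc.IH by (simp add: cfrac_then_Suc)
qed auto

text \<open>All later convergents share the first n + 1 digits and differ only in a complete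
  quotient. In \<open>cfrac_then_diff\<close> the numerator is at most t s and the denominator at
  least n t s, which leaves 1 / n.\<close>

lemma convergent_finite_cfrac: "convergent (\<lambda>n. finite_cfrac (map c [0..<Suc n]))"
proof (rule Cauchy_convergent, rule metric_CauchyI)
  fix e :: real assume e: "e > 0"
  obtain n where n: "real n > 1 / e" using reals_Archimedean2 by blast
  have n0: "n > 0" "1 / real n < e"
  proof -
    show "n > 0" using n e by (cases n) (auto simp: field_simps)
    then show "1 / real n < e" using n e by (simp add: field_simps)
  qed
  have merge: "\<exists>t\<ge>1. finite_cfrac (map c [0..<Suc m]) = cfrac_then c (Suc n) t" if "m \<ge> Suc n" for m
    using cfrac_then_ge_1_merge[of "Suc n" "of_int (c m)" "m - Suc n"] that digit_ge_1[of m]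
    by (simp add: finite_cfrac_eq_cfrac_then del: upt_Suc)
  show "\<exists>N. \<forall>m\<ge>N. \<forall>k\<ge>N. dist (finite_cfrac (map c [0..<Suc m])) (finite_cfrac (map c [0..<Suc k])) < e"
  proof (intro exI allI impI)
    fix m k assume mk: "m \<ge> Suc n" "k \<ge> Suc n"
    obtain t where t: "t \<ge> 1" "finite_cfrac (map c [0..<Suc m]) = cfrac_then c (Suc n) t"
      using merge[OF mk(1)] by blast
    obtain s where s: "s \<ge> 1" "finite_cfrac (map c [0..<Suc k]) = cfrac_then c (Suc n) s"
      using merge[OF mk(2)] by blast
    define q q' where "q = real_of_int (cden c (Suc n))" and "q' = real_of_int (cden c n)"
    have q: "q \<ge> 1" "q' \<ge> 0" "q \<ge> n" using cden_pos[of n] cden_ge(1)[of n] by (auto simp: q_def q'_def)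
    have ts: "\<bar>t - s\<bar> \<le> t * s"
    proof -
      have "t * 1 \<le> t * s" "1 * s \<le> t * s" using t s by (intro mult_mono; simp)+
      then show ?thesis using t(1) s(1) by linarith
    qed
    have pos: "q * t \<ge> 1" "q * s \<ge> 1" using q t s mult_mono[of 1 q 1 t] mult_mono[of 1 q 1 s] by auto
    have "real n * (t * s) \<le> (q * q) * (t * s)"
      using q t s n0 mult_mono[of "real n" q 1 q] by (intro mult_right_mono) auto
    also have "\<dots> = (q * t) * (q * s)" by simp
    also have "\<dots> \<le> (q * t + q') * (q * s + q')" using pos q by (intro mult_mono) auto
    finally have den: "real n * (t * s) \<le> (q * t + q') * (q * s + q')" .
    have "dist (finite_cfrac (map c [0..<Suc m])) (finite_cfrac (map c [0..<Suc k]))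
        = \<bar>t - s\<bar> / ((q * t + q') * (q * s + q'))"
      using cfrac_then_diff[of t s n] t s by (simp add: dist_real_def q_def q'_def del: upt_Suc)
    also have "\<dots> \<le> (t * s) / (real n * (t * s))"
      using ts den n0 t s by (intro frac_le) auto
    also have "\<dots> = 1 / real n" using t s by simp
    also have "\<dots> < e" by (rule n0)
    finally show "dist (finite_cfrac (map c [0..<Suc m])) (finite_cfrac (map c [0..<Suc k])) < e" .
  qed
qed

lemma shifted_digits: "cfrac_digits (\<lambda>i. c (i + n))"
  by unfold_locales (simp add: digit_ge_1)

lemma finite_cfrac_LIMSEQ: "(\<lambda>n. finite_cfrac (map c [0..<Suc n])) \<longlonglongrightarrow> cfrac_value c"
  using convergent_finite_cfrac unfolding cfrac_value_def convergent_LIMSEQ_iff .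

lemma cfrac_then_shift_ge_1:
  assumes "t \<ge> 1"
  shows "cfrac_then (c \<circ> Suc) n t \<ge> 1"
  using assms
proof (induction n arbitrary: t)
  case (Suc n)
  have "real_of_int (c (Suc n)) \<ge> 1" using digit_ge_1[of "Suc n"] by simp
  moreover have "1 / t \<ge> 0" using Suc.prems by simp
  ultimately have "of_int ((c \<circ> Suc) n) + 1 / t \<ge> 1" unfolding comp_def by linarith
  then show ?case using Suc.IH by (simp only: cfrac_then_Suc)
qed (simp add: cfrac_then_0)

lemma finite_cfrac_bounds:
  "of_int (c 0) \<le> finite_cfrac (map c [0..<Suc n])" "finite_cfrac (map c [0..<Suc n]) \<le> of_int (c 0) + 1"
proof -
  have "of_int (c 0) \<le> finite_cfrac (map c [0..<Suc n]) \<and> finite_cfrac (map c [0..<Suc n]) \<le> of_int (c 0) + 1"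
  proof (cases n)
    case (Suc k)
    have "cfrac_then (c \<circ> Suc) k (of_int (c (Suc k))) \<ge> 1"
      using digit_ge_1[of "Suc k"] by (intro cfrac_then_shift_ge_1) simp
    then show ?thesis
      unfolding finite_cfrac_eq_cfrac_then Suc cfrac_then_front by simp
  qed simp
  then show "of_int (c 0) \<le> finite_cfrac (map c [0..<Suc n])" "finite_cfrac (map c [0..<Suc n]) \<le> of_int (c 0) + 1"
    by blast+
qed

lemma cfrac_value_bounds: "of_int (c 0) \<le> cfrac_value c" "cfrac_value c \<le> of_int (c 0) + 1"
  using LIMSEQ_le_const[OF finite_cfrac_LIMSEQ] LIMSEQ_le_const2[OF finite_cfrac_LIMSEQ]
    finite_cfrac_bounds by meson+

lemma cfrac_value_unfold: "cfrac_value c = of_int (c 0) + 1 / cfrac_value (c \<circ> Suc)"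
proof -
  interpret s: cfrac_digits "c \<circ> Suc" by unfold_locales (simp add: digit_ge_1)
  have ge: "cfrac_value (c \<circ> Suc) \<ge> 1" using s.cfrac_value_bounds(1) digit_ge_1[of 1] by simp
  have "finite_cfrac (map c [0..<Suc (Suc n)]) = of_int (c 0) + 1 / finite_cfrac (map (c \<circ> Suc) [0..<Suc n])" for n
    by (simp only: finite_cfrac_eq_cfrac_then cfrac_then_front comp_def)
  moreover have "(\<lambda>n. of_int (c 0) + 1 / finite_cfrac (map (c \<circ> Suc) [0..<Suc n]))
      \<longlonglongrightarrow> of_int (c 0) + 1 / cfrac_value (c \<circ> Suc)"
    using ge by (intro tendsto_intros s.finite_cfrac_LIMSEQ) auto
  ultimately have "(\<lambda>n. finite_cfrac (map c [0..<Suc (Suc n)])) \<longlonglongrightarrow> of_int (c 0) + 1 / cfrac_value (c \<circ> Suc)"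
    by presburger
  moreover have "(\<lambda>n. finite_cfrac (map c [0..<Suc (Suc n)])) \<longlonglongrightarrow> cfrac_value c"
    using LIMSEQ_Suc[OF finite_cfrac_LIMSEQ] .
  ultimately show ?thesis using LIMSEQ_unique by blast
qed

lemma cfrac_value_eq_cfrac_then: "cfrac_value c = cfrac_then c n (cfrac_value (\<lambda>i. c (i + n)))"
proof (induction n)
  case (Suc n)
  interpret s: cfrac_digits "\<lambda>i. c (i + n)" by (rule shifted_digits)
  have "cfrac_value (\<lambda>i. c (i + n)) = of_int (c n) + 1 / cfrac_value (\<lambda>i. c (i + Suc n))"
    using s.cfrac_value_unfold by (simp add: comp_def)
  then show ?case using Suc by (simp add: cfrac_then_Suc)
qed (simp add: cfrac_then_0)

end

section \<open>The numbers \<open>\<xi>\<^sub>w\<close>\<close>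

locale sparse_cfrac =
  fixes a b :: int and w :: real
  assumes a_pos: "a > 0" and b_pos: "b > 0" and a_neq_b: "a \<noteq> b" and w_ge: "w \<ge> 4"
begin

definition c :: "nat \<Rightarrow> int" where
  "c n = (if n = 0 then 0 else a_seq a b w n)"

text \<open>An upper bound for \<open>lam\<close> and for all complete quotients of \<xi> from index
  1 on.\<close>

definition M :: real where "M = of_int (max a b) + 1"

text \<open>The value of the continued fraction with all digits a, that is, the positive root of X^2
  = a X + 1.\<close>

definition lam :: real where "lam = (of_int a + sqrt ((of_int a)\<^sup>2 + 4)) / 2"

text \<open>The exponent starts at 1: the digit b at index 1, which comes from w^0, is left out so
  that at least two indices precede every \<open>pos j\<close>.\<close>

definition pos :: "nat \<Rightarrow> nat" where "pos j = nat \<lfloor>w ^ Suc j\<rfloor>"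

lemma c_cases: "n \<ge> 1 \<Longrightarrow> c n = a \<or> c n = b"
  by (auto simp: c_def a_seq_def)

sublocale cfrac_digits c
  by unfold_locales (use c_cases a_pos b_pos in force)

lemma xi_eq: "xi a b w = cfrac_value c"
  by (simp add: xi_def c_def[abs_def])

lemma M_bounds: "M \<ge> 2" "of_int a + 1 \<le> M" "of_int b + 1 \<le> M"
  using a_pos b_pos by (auto simp: M_def)

lemma digit_le_M: "of_int (c n) + 1 \<le> M"
  using c_cases[of n] M_bounds by (cases "n = 0") (auto simp: c_def)

lemma lam_bounds: "lam > 1" "lam \<le> M" "lam > 0"
  and lam_square: "lam\<^sup>2 = of_int a * lam + 1"
  and lam_unfold: "lam = of_int a + 1 / lam"
proof -
  define s where "s = sqrt ((real_of_int a)\<^sup>2 + 4)"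
  have s2: "s\<^sup>2 = (real_of_int a)\<^sup>2 + 4" by (simp add: s_def)
  have s: "s > of_int a" unfolding s_def by (rule real_less_rsqrt) simp
  have a1: "real_of_int a \<ge> 1" using a_pos by simp
  have sq: "lam\<^sup>2 = of_int a * lam + 1"
    unfolding lam_def s_def[symmetric] using s2 by (simp add: power2_eq_square field_simps)
  have l1: "lam > of_int a" using s by (simp add: lam_def s_def)
  have l0: "lam > 0" using l1 a1 by linarith
  show "lam\<^sup>2 = of_int a * lam + 1" by (rule sq)
  show "lam > 1" "lam > 0" using l1 a1 by linarith+
  show u: "lam = of_int a + 1 / lam" using sq l0 by (simp add: field_simps power2_eq_square)
  have "1 / lam \<le> 1" using l1 a1 by simp
  then show "lam \<le> M" using u M_bounds by linarith
qed

text \<open>A rational \<open>lam\<close> would be an integer by integrality, and then a divisor of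
  1.\<close>

lemma lam_not_rat: "lam \<notin> \<rat>"
proof
  assume "lam \<in> \<rat>"
  moreover have "algebraic_int lam"
  proof (rule algebraic_int.intros)
    show "lead_coeff [:-1, - of_int a, 1 :: real:] = 1" by simp
    show "\<forall>i. coeff [:-1, - of_int a, 1 :: real:] i \<in> \<int>"
      by (auto simp: coeff_pCons split: nat.splits)
    show "poly [:-1, - of_int a, 1:] lam = 0"
      using lam_square by (simp add: power2_eq_square algebra_simps)
  qed
  ultimately have "lam \<in> \<int>" using rational_algebraic_int_is_int by blast
  then obtain k where k: "lam = of_int k" by (auto elim: Ints_cases)
  have "real_of_int (k * (k - a)) = 1" using lam_square by (simp add: k power2_eq_square algebra_simps)
  then have "k * (k - a) = 1" by linarith
  then have "k = 1 \<or> k = -1" using zmult_eq_1_iff by blast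
  then show False using lam_bounds(1) k by auto
qed

lemma lam_linear_independent:
  assumes "of_int u + of_int v * lam = 0"
  shows "u = 0 \<and> v = 0"
proof -
  have "v = 0"
  proof (rule ccontr)
    assume "v \<noteq> 0"
    then have "lam = of_int (- u) / of_int v" using assms by (simp add: field_simps)
    then show False using lam_not_rat by (metis Rats_divide Rats_of_int)
  qed
  then show ?thesis using assms by simp
qed

text \<open>Here \<open>r\<close> is either a tail of the expansion starting at a digit \<open>b\<close>, or a quotient of
  consecutive denominators ending in such a digit.\<close>

lemma b_tail_gap:
  assumes "r = of_int b + 1 / r'" "1 \<le> r'" "r' \<le> M"
  shows "1 / M \<le> \<bar>r - lam\<bar>"
proof -
  have r': "1 / M \<le> 1 / r'" "1 / r' \<le> 1" using assms M_bounds by (auto simp: frac_le)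
  have l: "1 / M \<le> 1 / lam" "1 / lam \<le> 1" using lam_bounds M_bounds by (auto simp: frac_le)
  \<comment> \<open>r - lam is the nonzero integer b - a plus a difference of two numbers in
    [1 / M, 1], which is at most 1 - 1 / M in absolute value.\<close>
  have "b \<ge> a + 1 \<or> a \<ge> b + 1" using a_neq_b by linarith
  then have "real_of_int b \<ge> of_int a + 1 \<or> real_of_int a \<ge> of_int b + 1" by linarith
  then show ?thesis using r' l assms(1) lam_unfold by linarith
qed

section \<open>Positions of the digit b\<close>

lemma power_w_ge: "w ^ Suc j \<ge> (real j + 2)\<^sup>2"
proof (induction j)
  case 0
  then show ?case using w_ge by simp
next
  case (Suc j)
  have "(real (Suc j) + 2)\<^sup>2 \<le> 4 * (real j + 2)\<^sup>2" by (simp add: power2_eq_square algebra_simps)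
  also have "\<dots> \<le> w * w ^ Suc j" using Suc w_ge by (intro mult_mono) auto
  finally show ?case by simp
qed

lemma pos_bounds: "real (pos j) \<le> w ^ Suc j" "w ^ Suc j < real (pos j) + 1" "pos j \<ge> j + 2"
proof -
  have "w ^ Suc j \<ge> 0" using w_ge by simp
  then show 1: "real (pos j) \<le> w ^ Suc j" "w ^ Suc j < real (pos j) + 1"
    unfolding pos_def by linarith+
  have "real j + 2 \<le> (real j + 2)\<^sup>2" by (simp add: power2_eq_square algebra_simps)
  then have "real (j + 2) < real (pos j) + 1" using power_w_ge[of j] 1 by simp
  then show "pos j \<ge> j + 2" by linarith
qed

lemma pos_less: "pos j < pos (Suc j)"
proof -
  have "w ^ Suc j \<ge> 1" using w_ge by (intro one_le_power) simp
  then have "w ^ Suc j + 1 \<le> 4 * w ^ Suc j" by linarith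
  also have "\<dots> \<le> w ^ Suc (Suc j)" using w_ge by simp
  finally have "real (pos j) < real (pos (Suc j))"
    using pos_bounds(1)[of j] pos_bounds(2)[of "Suc j"] by linarith
  then show ?thesis by simp
qed

lemma int_pos: "int (pos j) = \<lfloor>w ^ Suc j\<rfloor>"
  using w_ge by (simp add: pos_def)

lemma c_pos: "c (pos j) = b"
proof -
  have "\<exists>i. int (pos j) = \<lfloor>w ^ i\<rfloor>" using int_pos by blast
  then show ?thesis using pos_bounds(3)[of j] by (simp add: c_def a_seq_def)
qed

lemma c_between:
  assumes "pos j < k" "k < pos (Suc j)"
  shows "c k = a"
proof -
  have "int k \<noteq> \<lfloor>w ^ i\<rfloor>" for i
  proof (cases "i \<le> Suc j")
    case True
    then have "w ^ i \<le> w ^ Suc j" using w_ge by (intro power_increasing) auto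
    then have "\<lfloor>w ^ i\<rfloor> \<le> int (pos j)" unfolding int_pos by (rule floor_mono)
    then show ?thesis using assms by simp
  next
    case False
    then have "w ^ Suc (Suc j) \<le> w ^ i" using w_ge by (intro power_increasing) auto
    then have "int (pos (Suc j)) \<le> \<lfloor>w ^ i\<rfloor>" unfolding int_pos by (rule floor_mono)
    then show ?thesis using assms by simp
  qed
  then show ?thesis using assms by (simp add: c_def a_seq_def)
qed

section \<open>The quadratic numbers \<open>\<alpha> j\<close> and the size of the
  denominators\<close>

definition \<alpha> :: "nat \<Rightarrow> real" where "\<alpha> j = cfrac_then c (Suc (pos j)) lam"

text \<open>The digits strictly between two positions of b are a, and lam = a + 1 / lam. So
  \<open>\<alpha> j\<close> shares with \<xi> all digits before \<open>pos (Suc j)\<close>, which is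
  why its distance from \<xi> is governed by the index \<open>Suc j\<close>.\<close>

lemma alpha_eq: "\<alpha> j = cfrac_then c (pos (Suc j)) lam"
proof -
  have "k \<le> pos (Suc j) \<Longrightarrow> cfrac_then c k lam = \<alpha> j" if "Suc (pos j) \<le> k" for k
    using that
  proof (induction k rule: dec_induct)
    case base
    then show ?case by (simp add: \<alpha>_def)
  next
    case (step k)
    have "c k = a" using step by (intro c_between[of j]) auto
    then show ?case using step lam_unfold by (simp add: cfrac_then_Suc)
  qed
  then show ?thesis using pos_less[of j] by simp
qed

definition tail :: "nat \<Rightarrow> real" where "tail n = cfrac_value (\<lambda>i. c (i + n))"

lemma xi_eq_tail: "xi a b w = cfrac_then c n (tail n)"
  unfolding xi_eq tail_def by (rule cfrac_value_eq_cfrac_then)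

lemma tail_bounds:
  assumes "n \<ge> 1"
  shows "1 \<le> tail n" "tail n \<le> M"
proof -
  interpret s: cfrac_digits "\<lambda>i. c (i + n)" by (rule shifted_digits)
  have "real_of_int (c n) \<ge> 1" using digit_ge_1[OF assms] by simp
  then show "1 \<le> tail n" "tail n \<le> M"
    using s.cfrac_value_bounds digit_le_M[of n] by (auto simp: tail_def)
qed

lemma tail_unfold: "tail n = of_int (c n) + 1 / tail (Suc n)"
proof -
  interpret s: cfrac_digits "\<lambda>i. c (i + n)" by (rule shifted_digits)
  show ?thesis using s.cfrac_value_unfold by (simp add: tail_def comp_def)
qed

lemma tail_pos_gap: "1 / M \<le> \<bar>tail (pos j) - lam\<bar>"
  using tail_unfold[of "pos j"] tail_bounds[of "Suc (pos j)"]
  by (intro b_tail_gap) (auto simp: c_pos)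

text \<open>The Moebius denominator at \<open>lam\<close>. It is comparable to
  \<open>cden c (Suc n)\<close>, but at a digit a it is multiplied by exactly \<open>lam\<close>,
  because lam^2 = a lam + 1.\<close>

definition V :: "nat \<Rightarrow> real" where
  "V n = of_int (cden c (Suc n)) * lam + of_int (cden c n)"

lemma V_ge: "V n \<ge> of_int (cden c (Suc n))" "V n \<ge> 1"
proof -
  have "real_of_int (cden c (Suc n)) * 1 \<le> of_int (cden c (Suc n)) * lam"
    using cden_pos[of n] lam_bounds by (intro mult_left_mono) auto
  then show "V n \<ge> of_int (cden c (Suc n))" using cden_pos(2)[of n] unfolding V_def by linarith
  then show "V n \<ge> 1" using cden_pos[of n] by linarith
qed

lemma V_Suc_a:
  assumes "c (Suc n) = a"
  shows "V (Suc n) = lam * V n"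
proof -
  have "V (Suc n) = of_int (cden c (Suc n)) * (of_int a * lam + 1) + of_int (cden c n) * lam"
    using assms by (simp add: V_def algebra_simps)
  also have "\<dots> = lam * V n"
    unfolding lam_square[symmetric] by (simp add: V_def power2_eq_square algebra_simps)
  finally show ?thesis .
qed

lemma V_Suc_bounds: "V n \<le> V (Suc n)" "V (Suc n) \<le> 3 * M * V n"
proof -
  define q q' x where "q = real_of_int (cden c (Suc n))" and "q' = real_of_int (cden c n)"
    and "x = real_of_int (c (Suc n))"
  have q: "q \<ge> 1" "q' \<ge> 0" "q' \<le> q" using cden_pos[of n] cden_Suc_le[of n] by (auto simp: q_def q'_def)
  have x: "x \<ge> 1" "x \<le> M" using digit_ge_1[of "Suc n"] digit_le_M[of "Suc n"] by (auto simp: x_def)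
  have V: "V n = q * lam + q'" and VS: "V (Suc n) = (x * q + q') * lam + q"
    by (auto simp: V_def q_def q'_def x_def)
  have "q * lam \<le> (x * q + q') * lam"
  proof (rule mult_right_mono)
    have "1 * q \<le> x * q" using x q by (intro mult_right_mono) auto
    then show "q \<le> x * q + q'" using q by linarith
  qed (use lam_bounds in simp)
  then show "V n \<le> V (Suc n)" using q by (simp add: V VS)
  have V0: "q \<le> V n" "q' \<le> V n" "V n \<ge> 0" using V_ge[of n] q by (auto simp: q_def)
  have "V (Suc n) = x * (q * lam) + lam * q' + 1 * q" by (simp add: VS algebra_simps)
  also have "\<dots> \<le> M * V n + M * V n + M * V n"
    using x q V0 lam_bounds M_bounds V by (intro add_mono mult_mono) auto
  finally show "V (Suc n) \<le> 3 * M * V n" by simp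
qed

text \<open>Its square is the \<open>T j\<close> of the abstract setting.\<close>

definition Y :: "nat \<Rightarrow> real" where "Y j = V (pos j)"

lemma Y_ge: "Y j \<ge> 1" "Y j \<ge> real j"
proof -
  show "Y j \<ge> 1" by (simp add: Y_def V_ge)
  have "real (pos j) \<le> of_int (cden c (Suc (pos j)))" using cden_ge(1)[of "pos j"] by linarith
  then show "Y j \<ge> real j" using V_ge(1)[of "pos j"] pos_bounds(3)[of j] by (simp add: Y_def)
qed

lemma V_before_pos: "V (pos (Suc j) - 1) = lam ^ (pos (Suc j) - 1 - pos j) * Y j"
proof -
  have "k < pos (Suc j) \<Longrightarrow> V k = lam ^ (k - pos j) * Y j" if "pos j \<le> k" for k
    using that
  proof (induction k rule: dec_induct)
    case base
    then show ?case by (simp add: Y_def)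
  next
    case (step k)
    have "V (Suc k) = lam * V k" using step by (intro V_Suc_a c_between[of j]) auto
    then show ?case using step by (simp add: Suc_diff_le)
  qed
  then show ?thesis using pos_less[of j] by simp
qed

lemma Y_Suc_bounds: "V (pos (Suc j) - 1) \<le> Y (Suc j)" "Y (Suc j) \<le> 3 * M * V (pos (Suc j) - 1)"
  using V_Suc_bounds[of "pos (Suc j) - 1"] pos_less[of j] by (auto simp: Y_def)

text \<open>Both \<open>t\<close> and \<open>lam\<close> lie in [1, M], so exchanging them changes
  the denominator by a factor of at most M.\<close>

lemma moebius_den_bounds:
  assumes "1 \<le> t" "t \<le> M"
  shows "V n / M \<le> of_int (cden c (Suc n)) * t + of_int (cden c n)"
    "of_int (cden c (Suc n)) * t + of_int (cden c n) \<le> M * V n"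
proof -
  define q q' where "q = real_of_int (cden c (Suc n))" and "q' = real_of_int (cden c n)"
  have q: "q \<ge> 1" "q' \<ge> 0" using cden_pos[of n] by (auto simp: q_def q'_def)
  have V: "V n = q * lam + q'" by (auto simp: V_def q_def q'_def)
  have "q * lam + 1 * q' \<le> (q * t) * M + M * q'"
  proof (rule add_mono)
    have "q * lam \<le> q * M" using q lam_bounds by (intro mult_left_mono) auto
    also have "\<dots> \<le> (q * t) * M" using q assms M_bounds by (intro mult_right_mono) auto
    finally show "q * lam \<le> (q * t) * M" .
  qed (use q M_bounds in \<open>intro mult_right_mono; auto\<close>)
  then have "V n \<le> M * (q * t + q')" by (simp add: V algebra_simps)
  then have "V n / M \<le> q * t + q'" using M_bounds by (simp add: field_simps)
  then show "V n / M \<le> of_int (cden c (Suc n)) * t + of_int (cden c n)" by (simp add: q_def q'_def)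
  have "q * t + 1 * q' \<le> (q * lam) * M + M * q'"
  proof (rule add_mono)
    have "q * t \<le> q * M" using q assms by (intro mult_left_mono) auto
    also have "\<dots> \<le> (q * lam) * M" using q lam_bounds M_bounds by (intro mult_right_mono) auto
    finally show "q * t \<le> (q * lam) * M" .
  qed (use q M_bounds in \<open>intro mult_right_mono; auto\<close>)
  then have "q * t + q' \<le> M * V n" by (simp add: V algebra_simps)
  then show "of_int (cden c (Suc n)) * t + of_int (cden c n) \<le> M * V n" by (simp add: q_def q'_def)
qed

text \<open>Dictated by the upper bound in \<open>xi_alpha_dist\<close>: (3 M)^2 from comparing
  \<open>Y (Suc j)\<close> with \<open>V\<close>, one M from the gap between the quotients and one
  from the denominator.\<close>

definition K :: real where "K = 9 * M ^ 4"

lemma K_ge: "K \<ge> 1" "K \<ge> 9 * M\<^sup>2" "K \<ge> 9 * M" "K \<ge> M"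
proof -
  have m: "M ^ 1 \<le> M ^ 4" "M ^ 2 \<le> M ^ 4" using M_bounds by (intro power_increasing; simp)+
  then show "K \<ge> 9 * M\<^sup>2" "K \<ge> 9 * M" by (auto simp: K_def)
  then show "K \<ge> M" "K \<ge> 1" using M_bounds by linarith+
qed

text \<open>At index \<open>pos (Suc j)\<close> the expansion of \<xi> continues with a tail
  beginning with b, that of \<open>\<alpha> j\<close> with \<open>lam\<close>. These differ by an
  amount between 1 / M and M, and both denominators in \<open>cfrac_then_diff\<close> are comparable
  to \<open>Y (Suc j)\<close>.\<close>

lemma xi_alpha_dist:
  "1 \<le> K * (Y (Suc j))\<^sup>2 * \<bar>xi a b w - \<alpha> j\<bar>"
  "(Y (Suc j))\<^sup>2 * \<bar>xi a b w - \<alpha> j\<bar> \<le> K"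
proof -
  define n t where "n = pos (Suc j) - 1" and "t = tail (pos (Suc j))"
  have Sn: "Suc n = pos (Suc j)" using pos_less[of j] by (simp add: n_def)
  have t: "1 \<le> t" "t \<le> M" using tail_bounds[of "pos (Suc j)"] pos_bounds(3)[of "Suc j"] by (auto simp: t_def)
  have gap: "1 / M \<le> \<bar>t - lam\<bar>" "\<bar>t - lam\<bar> \<le> M"
    using tail_pos_gap[of "Suc j"] t lam_bounds by (auto simp: t_def)
  define x where "x = of_int (cden c (Suc n)) * t + of_int (cden c n)"
  have x: "V n / M \<le> x" "x \<le> M * V n" using moebius_den_bounds[OF t] by (auto simp: x_def)
  have M0: "M > 0" using M_bounds by simp
  have V0: "V n \<ge> 1" by (rule V_ge)
  then have x0: "x > 0" using x(1) M0 by (smt (verit) divide_pos_pos)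
  have eq: "\<bar>xi a b w - \<alpha> j\<bar> = \<bar>t - lam\<bar> / (x * V n)"
    using cfrac_then_diff[of t lam n] t lam_bounds
    unfolding xi_eq_tail[of "pos (Suc j)"] alpha_eq Sn[symmetric] t_def[unfolded Sn[symmetric], symmetric]
    by (simp add: x_def V_def)
  have Y: "V n \<le> Y (Suc j)" "Y (Suc j) \<le> 3 * M * V n"
    using Y_Suc_bounds[of j] by (auto simp: n_def)
  have "(Y (Suc j))\<^sup>2 \<le> (3 * M * V n)\<^sup>2" using Y V0 by (intro power_mono) auto
  then have "(Y (Suc j))\<^sup>2 * \<bar>xi a b w - \<alpha> j\<bar> \<le> (3 * M * V n)\<^sup>2 * (M / (V n / M * V n))"
    unfolding eq using gap x V0 M0 x0 by (intro mult_mono frac_le) auto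
  also have "\<dots> = K" using V0 M0 by (simp add: K_def field_simps power2_eq_square power4_eq_xxxx)
  finally show "(Y (Suc j))\<^sup>2 * \<bar>xi a b w - \<alpha> j\<bar> \<le> K" .
  have "1 / M ^ 2 = (V n)\<^sup>2 * (1 / M / (M * V n * V n))"
    using V0 M0 by (simp add: field_simps power2_eq_square)
  also have "\<dots> \<le> (Y (Suc j))\<^sup>2 * \<bar>xi a b w - \<alpha> j\<bar>"
    unfolding eq using gap x V0 M0 x0 Y by (intro mult_mono frac_le power_mono) auto
  finally have "M\<^sup>2 * (1 / M ^ 2) \<le> M\<^sup>2 * ((Y (Suc j))\<^sup>2 * \<bar>xi a b w - \<alpha> j\<bar>)"
    by (intro mult_left_mono) auto
  also have "\<dots> \<le> K * ((Y (Suc j))\<^sup>2 * \<bar>xi a b w - \<alpha> j\<bar>)"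
    using K_ge(2) by (intro mult_right_mono) (auto intro: order_trans[of _ "9 * M\<^sup>2"])
  finally show "1 \<le> K * (Y (Suc j))\<^sup>2 * \<bar>xi a b w - \<alpha> j\<bar>" using M0 by (simp add: mult.assoc)
qed

text \<open>From j to j + 1 the run of digits a contributes its length times \<open>ln lam\<close>,
  and the digit b and the rounding in \<open>pos\<close> contribute bounded amounts, so the error
  grows at most linearly.\<close>

lemma ln_Y_asymptotic:
  obtains E where "E \<ge> 0" "\<And>j. \<bar>ln (Y j) - w ^ Suc j * ln lam\<bar> \<le> E * (real j + 1)"
proof -
  define l where "l = ln lam"
  have l: "l > 0" using lam_bounds by (simp add: l_def)
  define e where "e = (\<lambda>j. ln (Y j) - w ^ Suc j * l)"
  define m where "m = ln (3 * M)"
  have m: "m > 0" using M_bounds by (simp add: m_def)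
  define E where "E = m + 2 * l + \<bar>e 0\<bar>"
  have step: "\<bar>e (Suc j) - e j\<bar> \<le> m + 2 * l" for j
  proof -
    let ?U = "V (pos (Suc j) - 1)"
    have U: "?U \<ge> 1" by (rule V_ge)
    have "ln ?U = real (pos (Suc j) - 1 - pos j) * l + ln (Y j)"
      unfolding V_before_pos using Y_ge(1)[of j] lam_bounds by (simp add: ln_mult ln_realpow l_def)
    also have "real (pos (Suc j) - 1 - pos j) = real (pos (Suc j)) - 1 - real (pos j)"
      using pos_less[of j] by (simp add: of_nat_diff)
    finally have lnU: "ln ?U = (real (pos (Suc j)) - 1 - real (pos j)) * l + ln (Y j)" .
    have "ln ?U \<le> ln (Y (Suc j))" using Y_Suc_bounds[of j] U by simp
    moreover have "ln (Y (Suc j)) \<le> ln (3 * M * ?U)"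
      using Y_Suc_bounds[of j] U Y_ge(1)[of "Suc j"] M_bounds by simp
    then have "ln (Y (Suc j)) \<le> m + ln ?U" using U M_bounds by (simp add: ln_mult m_def)
    \<comment> \<open>The combined rounding error of the two floors.\<close>
    moreover define D where "D = (real (pos (Suc j)) - real (pos j)) - (w ^ Suc (Suc j) - w ^ Suc j)"
    have D: "-1 \<le> D" "D \<le> 1"
      using pos_bounds(1,2)[of j] pos_bounds(1,2)[of "Suc j"] unfolding D_def by linarith+
    have "(-1) * l \<le> D * l" "D * l \<le> 1 * l" using D l by (intro mult_right_mono; simp)+
    moreover have "(real (pos (Suc j)) - 1 - real (pos j)) * l = D * l + w ^ Suc (Suc j) * l - w ^ Suc j * l - l"
      by (simp add: D_def algebra_simps)
    ultimately show ?thesis using lnU m l unfolding e_def by linarith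
  qed
  have "\<bar>e j\<bar> \<le> E * (real j + 1)" for j
  proof (induction j)
    case 0
    then show ?case using m l by (simp add: E_def)
  next
    case (Suc j)
    have "\<bar>e (Suc j)\<bar> \<le> (m + 2 * l) + E * (real j + 1)" using step[of j] Suc by linarith
    also have "\<dots> \<le> E * (real (Suc j) + 1)" by (simp add: E_def algebra_simps)
    finally show ?case .
  qed
  moreover have "E \<ge> 0" using m l by (simp add: E_def)
  ultimately show ?thesis using that[of E] by (simp add: e_def l_def)
qed

text \<open>The error in \<open>ln_Y_asymptotic\<close> is linear in j, while by
  \<open>power_w_ge\<close> the main term of \<epsilon> \<open>ln (Y j)\<close> is at least
  quadratic; so the former exceeds the latter by a bounded amount only.\<close>

lemma Y_square_growth:
  assumes \<epsilon>: "\<epsilon> > 0"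
  shows "\<exists>C. \<forall>j. \<bar>ln ((Y (Suc j))\<^sup>2) - w * ln ((Y j)\<^sup>2)\<bar> \<le> \<epsilon> * ln ((Y j)\<^sup>2) + C"
proof -
  obtain E where E: "E \<ge> 0" "\<And>j. \<bar>ln (Y j) - w ^ Suc j * ln lam\<bar> \<le> E * (real j + 1)"
    using ln_Y_asymptotic by metis
  define l where "l = ln lam"
  have l: "l > 0" using lam_bounds by (simp add: l_def)
  \<comment> \<open>With x = j + 2 all terms combine into U x - u x^2, whose maximum is U^2 / (4
    u).\<close>
  define U u where "U = 2 * E * (1 + w + \<epsilon>)" and "u = 2 * \<epsilon> * l"
  have u: "u > 0" using \<epsilon> l by (simp add: u_def)
  have "\<bar>ln ((Y (Suc j))\<^sup>2) - w * ln ((Y j)\<^sup>2)\<bar> \<le> \<epsilon> * ln ((Y j)\<^sup>2) + U\<^sup>2 / (4 * u)" for j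
  proof -
    define e where "e = ln (Y j) - w ^ Suc j * l"
    define e' where "e' = ln (Y (Suc j)) - w ^ Suc (Suc j) * l"
    define x where "x = real j + 2"
    have "\<bar>e\<bar> \<le> E * (real j + 1)" using E(2)[of j] by (simp add: e_def l_def)
    also have "\<dots> \<le> E * x" using E(1) by (intro mult_left_mono) (auto simp: x_def)
    finally have e: "\<bar>e\<bar> \<le> E * x" .
    have e': "\<bar>e'\<bar> \<le> E * x" using E(2)[of "Suc j"] by (simp add: e'_def l_def x_def add.commute)
    have ln2: "ln ((Y i)\<^sup>2) = 2 * ln (Y i)" for i using Y_ge(1)[of i] by (simp add: ln_realpow)
    have we: "\<bar>w * e\<bar> \<le> w * (E * x)" using e w_ge by (simp add: abs_mult)
    have ee: "\<bar>\<epsilon> * e\<bar> \<le> \<epsilon> * (E * x)" using e \<epsilon> by (simp add: abs_mult)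
    have "\<epsilon> * l * x\<^sup>2 \<le> \<epsilon> * l * w ^ Suc j"
      using power_w_ge[of j] \<epsilon> l by (intro mult_left_mono) (auto simp: x_def)
    moreover have "\<epsilon> * ln (Y j) = \<epsilon> * e + \<epsilon> * l * w ^ Suc j" by (simp add: e_def algebra_simps)
    ultimately have 1: "\<epsilon> * l * x\<^sup>2 - \<epsilon> * (E * x) \<le> \<epsilon> * ln (Y j)" using ee by linarith
    have "ln (Y (Suc j)) - w * ln (Y j) = e' - w * e" by (simp add: e_def e'_def algebra_simps)
    then have 2: "\<bar>ln (Y (Suc j)) - w * ln (Y j)\<bar> \<le> E * x + w * (E * x)" using e' we by linarith
    have "2 * \<bar>ln (Y (Suc j)) - w * ln (Y j)\<bar> - 2 * (\<epsilon> * ln (Y j))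
        \<le> 2 * (E * x + w * (E * x)) - 2 * (\<epsilon> * l * x\<^sup>2 - \<epsilon> * (E * x))"
      using 1 2 by (intro diff_mono mult_left_mono) auto
    also have "\<dots> = U * x - u * x\<^sup>2" by (simp add: U_def u_def algebra_simps)
    also have "\<dots> \<le> U\<^sup>2 / (4 * u)"
    proof -
      have "0 \<le> (U - 2 * u * x)\<^sup>2" by simp
      also have "\<dots> = U\<^sup>2 - 4 * u * (U * x - u * x\<^sup>2)" by (simp add: power2_eq_square algebra_simps)
      finally have "(U * x - u * x\<^sup>2) * (4 * u) \<le> U\<^sup>2" by (simp add: mult.commute)
      then show ?thesis using u by (simp add: pos_le_divide_eq)
    qed
    finally have "2 * \<bar>ln (Y (Suc j)) - w * ln (Y j)\<bar> \<le> 2 * (\<epsilon> * ln (Y j)) + U\<^sup>2 / (4 * u)" by linarith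
    moreover have "\<bar>2 * ln (Y (Suc j)) - w * (2 * ln (Y j))\<bar> = 2 * \<bar>ln (Y (Suc j)) - w * ln (Y j)\<bar>" by (simp add: abs_if)
    ultimately show ?thesis unfolding ln2 by simp
  qed
  then show ?thesis by blast
qed

section \<open>Conjugation in Z[\<open>lam\<close>] and the integrality of the norm\<close>

definition lam' :: real where "lam' = of_int a - lam"

lemma lam'_eq: "lam' = - 1 / lam"
  using lam_unfold by (simp add: lam'_def)

lemma lam'_bound: "\<bar>lam'\<bar> \<le> 1"
  using lam_bounds by (simp add: lam'_eq)

text \<open>\<open>x\<close> is an element of Z[\<open>lam\<close>] and \<open>y\<close> its Galois
  conjugate. As a relation it passes through sums and products without a conjugation map on the
  reals.\<close>

definition conj_pair :: "real \<Rightarrow> real \<Rightarrow> bool" where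
  "conj_pair x y \<longleftrightarrow> (\<exists>u v. x = of_int u + of_int v * lam \<and> y = of_int u + of_int v * lam')"

lemma conj_pair_linear: "conj_pair (of_int v * lam + of_int u) (of_int v * lam' + of_int u)"
  unfolding conj_pair_def by (intro exI[of _ u] exI[of _ v]) simp

lemma conj_pair_of_int: "conj_pair (of_int u) (of_int u)"
  using conj_pair_linear[of 0 u] by simp

lemma conj_pair_add:
  assumes "conj_pair x y" "conj_pair x' y'"
  shows "conj_pair (x + x') (y + y')"
proof -
  obtain u v where 1: "x = of_int u + of_int v * lam" "y = of_int u + of_int v * lam'"
    using assms(1) unfolding conj_pair_def by blast
  obtain s t where 2: "x' = of_int s + of_int t * lam" "y' = of_int s + of_int t * lam'"
    using assms(2) unfolding conj_pair_def by blast
  show ?thesis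
    unfolding conj_pair_def 1 2
    by (intro exI[of _ "u + s"] exI[of _ "v + t"]) (simp add: algebra_simps)
qed

lemma conj_pair_mult:
  assumes "conj_pair x y" "conj_pair x' y'"
  shows "conj_pair (x * x') (y * y')"
proof -
  obtain u v where 1: "x = of_int u + of_int v * lam" "y = of_int u + of_int v * lam'"
    using assms(1) unfolding conj_pair_def by blast
  obtain s t where 2: "x' = of_int s + of_int t * lam" "y' = of_int s + of_int t * lam'"
    using assms(2) unfolding conj_pair_def by blast
  have sq: "z\<^sup>2 = of_int a * z + 1 \<Longrightarrow> (of_int u + of_int v * z) * (of_int s + of_int t * z)
      = of_int (u * s + v * t) + of_int (u * t + v * s + a * (v * t)) * z" for z :: real
    by (simp add: power2_eq_square) algebra
  have "lam'\<^sup>2 = of_int a * lam' + 1"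
    using lam_square by (simp add: lam'_def power2_eq_square algebra_simps)
  then show ?thesis
    unfolding conj_pair_def 1 2 using sq[OF lam_square] sq[of lam'] by blast
qed

lemma conj_pair_power: "conj_pair x y \<Longrightarrow> conj_pair (x ^ n) (y ^ n)"
  by (induction n) (use conj_pair_of_int[of 1] conj_pair_mult in auto)

lemma conj_pair_sum:
  "(\<And>i. i \<in> A \<Longrightarrow> conj_pair (f i) (g i)) \<Longrightarrow> conj_pair (sum f A) (sum g A)"
  by (induction A rule: infinite_finite_induct) (use conj_pair_of_int[of 0] conj_pair_add in auto)

text \<open>The norm x y is the integer u^2 + a u v - v^2, nonzero because 1 and \<open>lam\<close>
  are linearly independent over the integers.\<close>

lemma conj_pair_norm_ge_1:
  assumes "conj_pair x y" "x \<noteq> 0"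
  shows "1 \<le> \<bar>x\<bar> * \<bar>y\<bar>"
proof -
  obtain u v where 1: "x = of_int u + of_int v * lam" "y = of_int u + of_int v * lam'"
    using assms(1) unfolding conj_pair_def by blast
  have "y \<noteq> 0"
  proof
    assume "y = 0"
    then have "of_int (u + a * v) + of_int (- v) * lam = 0" by (simp add: 1 lam'_def algebra_simps)
    then have "u + a * v = 0 \<and> - v = 0" by (rule lam_linear_independent)
    then show False using assms(2) by (auto simp: 1)
  qed
  have "x * y = of_int (u\<^sup>2 + a * u * v - v\<^sup>2)"
    using lam_square unfolding 1 lam'_def by (simp add: power2_eq_square) algebra
  then have "\<bar>x\<bar> * \<bar>y\<bar> = of_int \<bar>u\<^sup>2 + a * u * v - v\<^sup>2\<bar>" by (simp flip: abs_mult)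
  moreover have "\<bar>x\<bar> * \<bar>y\<bar> > 0" using \<open>y \<noteq> 0\<close> assms(2) by simp
  ultimately show ?thesis by (simp only: of_int_0_less_iff of_int_1_le_iff int_one_le_iff_zero_less)
qed

section \<open>Convergents at the digit b and the norm bound for
  P(\<open>\<alpha> j\<close>)\<close>

lemma cnum_bounds: "0 \<le> cnum c (Suc n)" "cnum c (Suc n) \<le> cden c (Suc n)"
proof -
  have "0 \<le> cnum c (Suc n) \<and> cnum c (Suc n) \<le> cden c (Suc n) \<and>
    0 \<le> cnum c (Suc (Suc n)) \<and> cnum c (Suc (Suc n)) \<le> cden c (Suc (Suc n))"
  proof (induction n)
    case 0
    then show ?case using digit_ge_1[of 1] by (simp add: c_def)
  next
    case (Suc n)
    have "c (Suc (Suc n)) \<ge> 0" using digit_ge_1[of "Suc (Suc n)"] by simp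
    then show ?case using Suc
      by (auto simp del: cnum.simps(3) cden.simps(3) simp: cnum.simps(3)[of c "Suc n"] cden.simps(3)[of c "Suc n"]
          intro!: add_mono mult_left_mono)
  qed
  then show "0 \<le> cnum c (Suc n)" "cnum c (Suc n) \<le> cden c (Suc n)" by auto
qed

text \<open>\<open>p\<close>, \<open>p'\<close>, \<open>q\<close>, \<open>q'\<close> are the entries
  of the matrix, of determinant 1 or -1, by which the digits up to \<open>pos j\<close> act; it
  takes \<open>lam\<close> to \<open>\<alpha> j\<close>.\<close>

definition p :: "nat \<Rightarrow> int" where "p j = cnum c (Suc (pos j))"
definition p' :: "nat \<Rightarrow> int" where "p' j = cnum c (pos j)"
definition q :: "nat \<Rightarrow> int" where "q j = cden c (Suc (pos j))"
definition q' :: "nat \<Rightarrow> int" where "q' j = cden c (pos j)"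

lemma pq_bounds: "0 \<le> p j" "p j \<le> q j" "0 \<le> p' j" "p' j \<le> q' j" "1 \<le> q' j" "q' j \<le> q j"
proof -
  obtain k where k: "pos j = Suc k" using pos_bounds(3)[of j] by (cases "pos j") auto
  show "0 \<le> p j" "p j \<le> q j" "0 \<le> p' j" "p' j \<le> q' j" "1 \<le> q' j" "q' j \<le> q j"
    using cnum_bounds[of "pos j"] cnum_bounds[of k] cden_ge(2)[of k] cden_Suc_le[of "pos j"]
    by (simp_all add: p_def p'_def q_def q'_def k del: cnum.simps(3) cden.simps(3))
qed

lemma pq_det: "(p j * q' j - p' j * q j)\<^sup>2 = 1"
  by (simp add: p_def p'_def q_def q'_def cnum_cden_det flip: power_mult)

lemma cfrac_then_pq:
  "t > 0 \<Longrightarrow> cfrac_then c (Suc (pos j)) t = (of_int (p j) * t + of_int (p' j)) / (of_int (q j) * t + of_int (q' j))"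
  by (simp add: cfrac_then_moebius p_def p'_def q_def q'_def)

lemma Y_eq: "Y j = of_int (q j) * lam + of_int (q' j)"
  by (simp add: Y_def V_def q_def q'_def)

lemma q_le_Y: "of_int (q j) \<le> Y j"
  using V_ge(1)[of "pos j"] by (simp add: Y_def q_def)

lemma alpha_times_Y: "\<alpha> j * Y j = of_int (p j) * lam + of_int (p' j)"
  using lam_bounds Y_ge(1)[of j] by (simp add: \<alpha>_def cfrac_then_pq Y_eq)

lemma alpha_bounds: "0 \<le> \<alpha> j" "\<alpha> j \<le> 1"
proof -
  have b: "0 \<le> real_of_int (p j) * lam + of_int (p' j)"
    "real_of_int (p j) * lam + of_int (p' j) \<le> of_int (q j) * lam + of_int (q' j)"
    using pq_bounds[of j] lam_bounds by (auto intro!: add_mono mult_right_mono)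
  have Y0: "Y j > 0" using Y_ge(1)[of j] by linarith
  show "0 \<le> \<alpha> j" using b(1) Y0 unfolding alpha_times_Y[symmetric] by (simp add: zero_le_mult_iff)
  have "\<alpha> j * Y j \<le> 1 * Y j" unfolding alpha_times_Y using b(2) by (simp add: Y_eq)
  then show "\<alpha> j \<le> 1" using Y0 by simp
qed

text \<open>Clearing denominators, Y_j^n P(\<open>\<alpha> j\<close>) is an element of
  Z[\<open>lam\<close>]. Its conjugate is at most (n + 1) H (2 Y_j)^n in absolute value, and its
  norm is at least 1.\<close>

lemma rpoly_alpha_lower_bound:
  assumes P: "degree P \<le> n" "rpoly P (\<alpha> j) \<noteq> 0"
  shows "1 / ((real n + 1) * 2 ^ n) \<le> \<bar>rpoly P (\<alpha> j)\<bar> * of_int (poly_height P) * ((Y j)\<^sup>2) ^ n"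
proof -
  define f where "f = (\<lambda>x. of_int (p j) * x + of_int (p' j) :: real)"
  define g where "g = (\<lambda>x. of_int (q j) * x + of_int (q' j) :: real)"
  \<comment> \<open>\<open>P\<close> homogenised to degree \<open>n\<close> and evaluated at the
    pair \<open>f x\<close>, \<open>g x\<close>; the quotient of \<open>f lam\<close> by
    \<open>g lam\<close> is \<open>\<alpha> j\<close>.\<close>
  define \<Phi> where "\<Phi> = (\<lambda>x. \<Sum>i\<le>n. of_int (coeff P i) * (f x ^ i * g x ^ (n - i)))"
  define H where "H = real_of_int (poly_height P)"
  have Y1: "Y j \<ge> 1" by (rule Y_ge)
  have "\<Phi> lam = (\<Sum>i\<le>n. Y j ^ n * (of_int (coeff P i) * \<alpha> j ^ i))"
    unfolding \<Phi>_def
  proof (rule sum.cong)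
    fix i assume i: "i \<in> {..n}"
    have "f lam = \<alpha> j * Y j" "g lam = Y j"
      unfolding f_def g_def alpha_times_Y by (simp_all add: Y_eq)
    then have "f lam ^ i * g lam ^ (n - i) = \<alpha> j ^ i * Y j ^ (i + (n - i))"
      by (simp add: power_mult_distrib power_add)
    then show "of_int (coeff P i) * (f lam ^ i * g lam ^ (n - i)) = Y j ^ n * (of_int (coeff P i) * \<alpha> j ^ i)"
      using i by simp
  qed simp
  then have \<Phi>_lam: "\<Phi> lam = Y j ^ n * rpoly P (\<alpha> j)"
    by (simp add: rpoly_as_sum[OF P(1)] sum_distrib_left)
  have "conj_pair (\<Phi> lam) (\<Phi> lam')"
    unfolding \<Phi>_def f_def g_def
    by (intro conj_pair_sum conj_pair_mult conj_pair_power conj_pair_linear conj_pair_of_int)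
  moreover have "\<Phi> lam \<noteq> 0" using \<Phi>_lam P(2) Y1 by simp
  ultimately have norm: "1 \<le> \<bar>\<Phi> lam\<bar> * \<bar>\<Phi> lam'\<bar>" by (rule conj_pair_norm_ge_1)
  have fg: "\<bar>of_int u * lam' + of_int v\<bar> \<le> 2 * Y j" if "0 \<le> u" "u \<le> q j" "0 \<le> v" "v \<le> q j" for u v
  proof -
    have "\<bar>of_int u * lam' + of_int v\<bar> \<le> \<bar>of_int u\<bar> * \<bar>lam'\<bar> + \<bar>of_int v\<bar>"
      using abs_triangle_ineq[of "of_int u * lam'" "of_int v"] by (simp add: abs_mult)
    also have "\<dots> \<le> of_int (q j) * 1 + of_int (q j)"
      using that lam'_bound by (intro add_mono mult_mono) auto
    also have "\<dots> \<le> 2 * Y j" using q_le_Y[of j] by simp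
    finally show ?thesis .
  qed
  have f: "\<bar>f lam'\<bar> \<le> 2 * Y j" and g: "\<bar>g lam'\<bar> \<le> 2 * Y j"
    unfolding f_def g_def using pq_bounds[of j] by (intro fg; linarith)+
  have "\<bar>\<Phi> lam'\<bar> \<le> (\<Sum>i\<le>n. \<bar>of_int (coeff P i) * (f lam' ^ i * g lam' ^ (n - i))\<bar>)"
    unfolding \<Phi>_def by (rule sum_abs)
  also have "\<dots> \<le> (\<Sum>i\<le>n. H * (2 * Y j) ^ n)"
  proof (rule sum_mono)
    fix i assume i: "i \<in> {..n}"
    have "\<bar>f lam'\<bar> ^ i * \<bar>g lam'\<bar> ^ (n - i) \<le> (2 * Y j) ^ i * (2 * Y j) ^ (n - i)"
      using f g Y1 by (intro mult_mono power_mono) auto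
    also have "\<dots> = (2 * Y j) ^ n" using i unfolding power_add[symmetric] by simp
    finally show "\<bar>of_int (coeff P i) * (f lam' ^ i * g lam' ^ (n - i))\<bar> \<le> H * (2 * Y j) ^ n"
      unfolding abs_mult power_abs
      using abs_coeff_le_poly_height[of P i] by (intro mult_mono) (auto simp: H_def)
  qed
  also have "\<dots> = ((real n + 1) * 2 ^ n) * (H * Y j ^ n)"
    by (simp add: power_mult_distrib algebra_simps)
  finally have "\<bar>\<Phi> lam\<bar> * \<bar>\<Phi> lam'\<bar> \<le> \<bar>\<Phi> lam\<bar> * (((real n + 1) * 2 ^ n) * (H * Y j ^ n))"
    by (rule mult_left_mono) simp
  with norm have "1 \<le> \<bar>\<Phi> lam\<bar> * (((real n + 1) * 2 ^ n) * (H * Y j ^ n))" by linarith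
  also have "\<bar>\<Phi> lam\<bar> = \<bar>rpoly P (\<alpha> j)\<bar> * Y j ^ n"
    using Y1 by (simp add: \<Phi>_lam abs_mult)
  finally have "1 \<le> ((real n + 1) * 2 ^ n) * (\<bar>rpoly P (\<alpha> j)\<bar> * H * ((Y j)\<^sup>2) ^ n)"
    by (simp add: power2_eq_square power_mult_distrib mult_ac)
  then show ?thesis
    unfolding H_def by (subst pos_divide_le_eq) (auto simp: mult_ac intro!: mult_pos_pos)
qed

section \<open>The minimal polynomials of the \<open>\<alpha> j\<close>\<close>

text \<open>The minimal polynomial \<open>X\<^sup>2 - a X - 1\<close> of \<open>lam\<close>, transformed by the inverse of the
  unimodular substitution that takes \<open>lam\<close> to \<open>\<alpha> j\<close>.\<close>

definition G :: "nat \<Rightarrow> int poly" where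
  "G j = [: (p' j)\<^sup>2 + a * p j * p' j - (p j)\<^sup>2,
            2 * p j * q j - 2 * p' j * q' j - a * (p j * q' j + p' j * q j),
            (q' j)\<^sup>2 + a * q j * q' j - (q j)\<^sup>2 :]"

definition F :: "nat \<Rightarrow> int poly" where
  "F j = smult (sgn (coeff (G j) 2)) (G j)"

lemma rpoly_G_cfrac_then:
  assumes "t > 0"
  shows "rpoly (G j) (cfrac_then c (Suc (pos j)) t) =
    (t\<^sup>2 - of_int a * t - 1) / (of_int (q j) * t + of_int (q' j))\<^sup>2"
proof -
  define P P' Q Q' where "P = real_of_int (p j)" and "P' = real_of_int (p' j)"
    and "Q = real_of_int (q j)" and "Q' = real_of_int (q' j)"
  define A where "A = real_of_int a"
  define x where "x = cfrac_then c (Suc (pos j)) t"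
  define D where "D = Q * t + Q'"
  have "Q \<ge> 1" "Q' \<ge> 0" using pq_bounds[of j] by (auto simp: Q_def Q'_def)
  then have D: "D > 0" using assms by (auto simp: D_def intro!: add_pos_nonneg)
  have xD: "x * D = P * t + P'"
    using D assms by (simp add: x_def cfrac_then_pq D_def P_def P'_def Q_def Q'_def)
  have "real_of_int ((p j * q' j - p' j * q j)\<^sup>2) = 1" unfolding pq_det by simp
  then have det: "(P * Q' - P' * Q)\<^sup>2 = 1" by (simp add: P_def P'_def Q_def Q'_def)
  have "rpoly (G j) x = (P'\<^sup>2 + A * P * P' - P\<^sup>2) + x * ((2 * P * Q - 2 * P' * Q' - A * (P * Q' + P' * Q))
      + x * (Q'\<^sup>2 + A * Q * Q' - Q\<^sup>2))"
    by (simp add: G_def map_poly_pCons P_def P'_def Q_def Q'_def A_def)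
  \<comment> \<open>Multiplication by D^2 lets x D be replaced by P t + P' without division and
    leaves the squared determinant as a factor.\<close>
  then have "rpoly (G j) x * D\<^sup>2 = (P'\<^sup>2 + A * P * P' - P\<^sup>2) * D\<^sup>2
      + (x * D) * ((2 * P * Q - 2 * P' * Q' - A * (P * Q' + P' * Q)) * D + (x * D) * (Q'\<^sup>2 + A * Q * Q' - Q\<^sup>2))"
    by algebra
  also have "\<dots> = (P * Q' - P' * Q)\<^sup>2 * (t\<^sup>2 - A * t - 1)"
    unfolding xD unfolding D_def by algebra
  finally have "rpoly (G j) x * D\<^sup>2 = t\<^sup>2 - A * t - 1" using det by simp
  then show ?thesis using D by (simp add: x_def D_def A_def Q_def Q'_def eq_divide_eq)
qed

lemma coeff_G:
  "coeff (G j) 0 = (p' j)\<^sup>2 + a * p j * p' j - (p j)\<^sup>2"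
  "coeff (G j) 1 = 2 * p j * q j - 2 * p' j * q' j - a * (p j * q' j + p' j * q j)"
  "coeff (G j) 2 = (q' j)\<^sup>2 + a * q j * q' j - (q j)\<^sup>2"
proof -
  have "coeff [:x, y, z:] 0 = x" "coeff [:x, y, z:] 1 = y" "coeff [:x, y, z:] 2 = z" for x y z :: int
    by (simp_all add: numeral_2_eq_2)
  then show "coeff (G j) 0 = (p' j)\<^sup>2 + a * p j * p' j - (p j)\<^sup>2"
    "coeff (G j) 1 = 2 * p j * q j - 2 * p' j * q' j - a * (p j * q' j + p' j * q j)"
    "coeff (G j) 2 = (q' j)\<^sup>2 + a * q j * q' j - (q j)\<^sup>2"
    unfolding G_def by blast+
qed

text \<open>The leading coefficient of \<open>G j\<close> is the norm of \<open>Y j\<close>.\<close>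

lemma G_lead_factor: "real_of_int (coeff (G j) 2) = Y j * (of_int (q j) * lam' + of_int (q' j))"
proof -
  define A x y where "A = real_of_int a" and "x = real_of_int (q j)" and "y = real_of_int (q' j)"
  have "lam\<^sup>2 = A * lam + 1" using lam_square by (simp add: A_def)
  then have "y\<^sup>2 + A * x * y - x\<^sup>2 = (x * lam + y) * (x * (A - lam) + y)" by algebra
  then show ?thesis by (simp add: coeff_G Y_eq lam'_def A_def x_def y_def)
qed

text \<open>The conjugate of \<open>Y j\<close> must not be small. It equals -(q' / lam) (q / q' -
  lam), and q / q' expands into the digits read backwards from \<open>pos j\<close>, beginning with
  b, so \<open>b_tail_gap\<close> applies.\<close>

lemma G_lead_bound: "(Y j)\<^sup>2 \<le> 2 * M ^ 4 * \<bar>of_int (coeff (G j) 2)\<bar>"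
proof -
  define x y where "x = real_of_int (q j)" and "y = real_of_int (q' j)"
  obtain k where k: "pos j = Suc (Suc k)"
    using pos_bounds(3)[of j] that[of "pos j - 2"] by simp
  define z where "z = real_of_int (cden c (Suc k))"
  have xyz: "x = of_int b * y + z" using c_pos[of j] by (simp add: x_def y_def z_def q_def q'_def k)
  have z: "1 \<le> z" "z \<le> y" using cden_pos[of k] cden_Suc_le[of "Suc k"]
    by (simp_all add: z_def y_def q'_def k del: cden.simps(3))
  have M0: "M > 0" using M_bounds by simp
  have yMz: "y \<le> M * z"
  proof -
    have "real_of_int (c (Suc k)) * z + of_int (cden c k) \<le> of_int (c (Suc k)) * z + 1 * z"
      using cden_Suc_le[of k] by (simp add: z_def)
    also have "\<dots> = (of_int (c (Suc k)) + 1) * z" by (simp add: algebra_simps)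
    also have "\<dots> \<le> M * z" using digit_le_M z by (intro mult_right_mono) auto
    finally show ?thesis by (simp add: y_def q'_def k z_def)
  qed
  have xMy: "x \<le> M * y"
  proof -
    have "x \<le> (of_int b + 1) * y" using xyz z by (simp add: algebra_simps)
    also have "\<dots> \<le> M * y" using M_bounds z by (intro mult_right_mono) auto
    finally show ?thesis .
  qed
  have "1 / M \<le> \<bar>x / y - lam\<bar>"
  proof (rule b_tail_gap[of _ "y / z"])
    show "x / y = of_int b + 1 / (y / z)" using xyz z by (simp add: field_simps)
    show "1 \<le> y / z" "y / z \<le> M" using z yMz by (auto simp: field_simps)
  qed
  moreover have "x * lam' + y = - (y / lam) * (x / y - lam)"
    using z lam_bounds by (simp add: lam'_eq field_simps)
  then have "\<bar>x * lam' + y\<bar> = y / lam * \<bar>x / y - lam\<bar>" using z lam_bounds by (simp add: abs_mult)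
  moreover have "y / M \<le> y / lam" using z lam_bounds by (intro divide_left_mono) auto
  moreover have "0 \<le> y / lam" using z lam_bounds by simp
  ultimately have "y / M * (1 / M) \<le> \<bar>x * lam' + y\<bar>"
    using M0 by (simp only: mult_mono abs_ge_zero zero_le_divide_1_iff less_imp_le)
  then have 1: "y \<le> M\<^sup>2 * \<bar>x * lam' + y\<bar>" using M0 by (simp add: field_simps power2_eq_square)
  have "Y j = x * lam + 1 * y" by (simp add: Y_eq x_def y_def)
  also have "\<dots> \<le> (M * y) * M + M\<^sup>2 * y"
    using xMy lam_bounds M0 z M_bounds xyz b_pos by (intro add_mono mult_mono) (auto intro: one_le_power)
  also have "\<dots> = 2 * M\<^sup>2 * y" by (simp add: power2_eq_square)
  also have "\<dots> \<le> 2 * M\<^sup>2 * (M\<^sup>2 * \<bar>x * lam' + y\<bar>)" using 1 by (intro mult_left_mono) auto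
  finally have 2: "Y j \<le> 2 * M ^ 4 * \<bar>x * lam' + y\<bar>" by (simp add: power2_eq_square power4_eq_xxxx mult_ac)
  have "(Y j)\<^sup>2 = Y j * Y j" by (simp add: power2_eq_square)
  also have "\<dots> \<le> Y j * (2 * M ^ 4 * \<bar>x * lam' + y\<bar>)" using 2 Y_ge(1)[of j] by (intro mult_left_mono) auto
  also have "\<dots> = 2 * M ^ 4 * \<bar>of_int (coeff (G j) 2)\<bar>"
    unfolding G_lead_factor using Y_ge(1)[of j] by (simp add: abs_mult x_def y_def)
  finally show ?thesis .
qed

lemma G_coeff_2_nonzero: "coeff (G j) 2 \<noteq> 0"
proof
  assume "coeff (G j) 2 = 0"
  then have "(Y j)\<^sup>2 \<le> 0" using G_lead_bound[of j] by simp
  then show False using Y_ge(1)[of j] by simp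
qed

lemma sgn_G: "\<bar>sgn (coeff (G j) 2)\<bar> = 1" "\<bar>real_of_int (sgn (coeff (G j) 2))\<bar> = 1"
  using G_coeff_2_nonzero[of j] by (simp_all add: sgn_if)

lemma degree_G: "degree (G j) = 2"
proof (rule antisym)
  show "degree (G j) \<le> 2" by (simp add: G_def)
  show "2 \<le> degree (G j)" using G_coeff_2_nonzero by (rule le_degree)
qed

lemma degree_F: "degree (F j) = 2"
  using G_coeff_2_nonzero[of j] degree_G[of j] by (simp add: F_def sgn_0_0)

lemma lead_F: "lead_coeff (F j) = \<bar>coeff (G j) 2\<bar>"
  unfolding degree_F by (auto simp: F_def sgn_if)

lemma rpoly_F: "rpoly (F j) x = of_int (sgn (coeff (G j) 2)) * rpoly (G j) x"
  by (simp add: F_def map_poly_of_int_smult)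

lemma abs_rpoly_F: "\<bar>rpoly (F j) x\<bar> = \<bar>rpoly (G j) x\<bar>"
  unfolding rpoly_F abs_mult sgn_G(2) by simp

lemma content_G: "content (G j) = 1"
proof -
  let ?g = "content (G j)"
  \<comment> \<open>The homogenised \<open>G j\<close> at the pair \<open>p' j\<close>,
    \<open>q' j\<close>, which is the image of t = 0, where t^2 - a t - 1 equals -1.\<close>
  have "?g dvd coeff (G j) 2 * (p' j)\<^sup>2 + coeff (G j) 1 * (p' j * q' j) + coeff (G j) 0 * (q' j)\<^sup>2"
    by (intro dvd_add dvd_mult2 content_dvd_coeff)
  moreover have "coeff (G j) 2 * (p' j)\<^sup>2 + coeff (G j) 1 * (p' j * q' j) + coeff (G j) 0 * (q' j)\<^sup>2
      = - ((p j * q' j - p' j * q j)\<^sup>2)"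
    unfolding coeff_G by algebra
  ultimately have "?g dvd - 1" by (simp only: pq_det)
  then have "is_unit ?g" by simp
  then show ?thesis by (rule is_unit_content_iff[THEN iffD1])
qed

lemma content_F: "content (F j) = 1"
  unfolding F_def using content_G[of j] sgn_G(1)[of j] by simp

text \<open>Multiplication by \<open>Y j\<close> gives a relation between 1 and \<open>lam\<close>
  whose coefficients arise from u and v by an invertible integer matrix.\<close>

lemma alpha_linear_independent:
  assumes "of_int u + of_int v * \<alpha> j = 0"
  shows "u = 0 \<and> v = 0"
proof -
  have "(of_int u + of_int v * \<alpha> j) * Y j = of_int (u * q' j + v * p' j) + of_int (u * q j + v * p j) * lam"
    unfolding distrib_right mult.assoc alpha_times_Y unfolding Y_eq by (simp add: algebra_simps)
  then have "of_int (u * q' j + v * p' j) + of_int (u * q j + v * p j) * lam = 0" using assms by simp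
  from lam_linear_independent[OF this] have 1: "u * q' j + v * p' j = 0" "u * q j + v * p j = 0" by auto
  have "u * (p j * q' j - p' j * q j) = 0" "v * (p j * q' j - p' j * q j) = 0" using 1 by algebra+
  moreover have "p j * q' j - p' j * q j \<noteq> 0" using pq_det[of j] by auto
  ultimately show ?thesis by simp
qed

lemma is_int_min_poly_F: "is_int_min_poly (\<alpha> j) (F j)"
  unfolding is_int_min_poly_def
proof (intro conjI allI impI)
  show "rpoly (F j) (\<alpha> j) = 0"
    using rpoly_G_cfrac_then[OF lam_bounds(3), of j] lam_square by (simp add: rpoly_F \<alpha>_def)
  show "content (F j) = 1" by (rule content_F)
  show "lead_coeff (F j) > 0" unfolding lead_F using G_coeff_2_nonzero[of j] by simp
  fix Q :: "int poly" assume Q: "Q \<noteq> 0" "rpoly Q (\<alpha> j) = 0"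
  show "degree (F j) \<le> degree Q"
  proof (rule ccontr)
    assume "\<not> degree (F j) \<le> degree Q"
    then have d: "degree Q \<le> 1" by (simp add: degree_F)
    then have "of_int (coeff Q 0) + of_int (coeff Q 1) * \<alpha> j = 0"
      using Q(2) by (simp add: rpoly_as_sum[OF d])
    then have "coeff Q 0 = 0 \<and> coeff Q 1 = 0" by (rule alpha_linear_independent)
    then have "lead_coeff Q = 0" using d by (cases "degree Q") auto
    then show False using Q(1) by simp
  qed
qed

lemma coeff_F_bound: "\<bar>of_int (coeff (F j) i)\<bar> \<le> K * (Y j)\<^sup>2"
proof -
  define x where "x = q j"
  have b: "0 \<le> p j" "p j \<le> x" "0 \<le> p' j" "p' j \<le> x" "0 \<le> q' j" "q' j \<le> x" "0 \<le> q j" "q j \<le> x"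
    using pq_bounds[of j] by (auto simp: x_def)
  have m: "0 \<le> u * v \<and> u * v \<le> x\<^sup>2 \<and> 0 \<le> a * (u * v) \<and> a * (u * v) \<le> a * x\<^sup>2"
    if "0 \<le> u" "u \<le> x" "0 \<le> v" "v \<le> x" for u v
  proof -
    have "u * v \<le> x\<^sup>2" unfolding power2_eq_square using that by (intro mult_mono) auto
    then show ?thesis using that a_pos by (auto intro!: mult_left_mono)
  qed
  \<comment> \<open>All matrix entries lie between 0 and \<open>q j\<close>; 4 + 2 a adds up the
    multiplicities of the products in the linear coefficient.\<close>
  have "\<bar>coeff (G j) i\<bar> \<le> (4 + 2 * a) * x\<^sup>2"
  proof -
    have x2: "0 \<le> a * x\<^sup>2" "0 \<le> x\<^sup>2" using a_pos by auto
    have "\<bar>(p' j)\<^sup>2 + a * p j * p' j - (p j)\<^sup>2\<bar> \<le> (4 + 2 * a) * x\<^sup>2"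
      using m[of "p' j" "p' j"] m[of "p j" "p' j"] m[of "p j" "p j"] b x2
      unfolding distrib_right power2_eq_square[of "p j"] power2_eq_square[of "p' j"] mult.assoc by linarith
    moreover have "\<bar>(q' j)\<^sup>2 + a * q j * q' j - (q j)\<^sup>2\<bar> \<le> (4 + 2 * a) * x\<^sup>2"
      using m[of "q' j" "q' j"] m[of "q j" "q' j"] m[of "q j" "q j"] b x2
      unfolding distrib_right power2_eq_square[of "q j"] power2_eq_square[of "q' j"] mult.assoc by linarith
    moreover have "\<bar>2 * p j * q j - 2 * p' j * q' j - a * (p j * q' j + p' j * q j)\<bar> \<le> (4 + 2 * a) * x\<^sup>2"
      using m[of "p j" "q j"] m[of "p' j" "q' j"] m[of "p j" "q' j"] m[of "p' j" "q j"] b x2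
      unfolding distrib_right distrib_left mult.assoc by linarith
    ultimately show ?thesis
      using x2 a_pos by (auto simp: G_def coeff_pCons split: nat.splits)
  qed
  then have "\<bar>coeff (F j) i\<bar> \<le> (4 + 2 * a) * x\<^sup>2"
    using sgn_G(1)[of j] by (simp add: F_def abs_mult)
  then have "real_of_int \<bar>coeff (F j) i\<bar> \<le> real_of_int ((4 + 2 * a) * x\<^sup>2)" by linarith
  also have "\<dots> = (4 + 2 * of_int a) * (of_int x)\<^sup>2" by simp
  also have "\<dots> \<le> K * (Y j)\<^sup>2"
  proof (rule mult_mono)
    show "4 + 2 * real_of_int a \<le> K" using M_bounds K_ge(3) by linarith
    show "(real_of_int x)\<^sup>2 \<le> (Y j)\<^sup>2" using q_le_Y[of j] b by (intro power_mono) (auto simp: x_def)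
  qed (use K_ge in auto)
  finally show ?thesis by simp
qed

text \<open>With \<open>t\<close> the tail after the digit b, \<open>rpoly_G_cfrac_then\<close> and
  \<open>cfrac_then_diff\<close> show that |F_j(\<xi>)| is |\<xi> - \<open>\<alpha> j\<close>| times
  (t + 1 / lam) (Y_j / x), a factor between 1 / M and 2 M^2.\<close>

lemma rpoly_F_xi:
  "\<bar>xi a b w - \<alpha> j\<bar> \<le> K * \<bar>rpoly (F j) (xi a b w)\<bar>"
  "\<bar>rpoly (F j) (xi a b w)\<bar> \<le> K * \<bar>xi a b w - \<alpha> j\<bar>"
proof -
  define t where "t = tail (Suc (pos j))"
  have t: "1 \<le> t" "t \<le> M" using tail_bounds[of "Suc (pos j)"] by (auto simp: t_def)
  define x where "x = of_int (q j) * t + of_int (q' j)"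
  have x: "Y j / M \<le> x" "x \<le> M * Y j"
    using moebius_den_bounds[OF t, of "pos j"] by (auto simp: x_def q_def q'_def Y_def)
  have M0: "M > 0" using M_bounds by simp
  have Y0: "Y j > 0" using Y_ge(1)[of j] by linarith
  have x0: "x > 0" using x(1) M0 Y0 by (smt (verit) divide_pos_pos)
  have xi: "xi a b w = cfrac_then c (Suc (pos j)) t" unfolding t_def by (rule xi_eq_tail)
  define d where "d = \<bar>xi a b w - \<alpha> j\<bar>"
  have d: "d = \<bar>t - lam\<bar> / (x * Y j)"
    using cfrac_then_diff[of t lam "pos j"] t lam_bounds
    by (simp add: d_def xi \<alpha>_def x_def Y_eq q_def q'_def)
  have "t\<^sup>2 - of_int a * t - 1 = (t - lam) * (t - lam')"
    using lam_square by (simp add: lam'_def power2_eq_square algebra_simps)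
  then have "\<bar>rpoly (F j) (xi a b w)\<bar> = \<bar>t - lam\<bar> * \<bar>t - lam'\<bar> / x\<^sup>2"
    unfolding abs_rpoly_F xi using rpoly_G_cfrac_then[of t j] t by (simp add: x_def abs_mult)
  also have "\<bar>t - lam'\<bar> = t + 1 / lam" using t lam_bounds by (simp add: lam'_eq)
  also have "\<bar>t - lam\<bar> * (t + 1 / lam) / x\<^sup>2 = d * ((t + 1 / lam) * (Y j / x))"
    using x0 Y0 by (simp add: d power2_eq_square field_simps)
  finally have eq: "\<bar>rpoly (F j) (xi a b w)\<bar> = d * ((t + 1 / lam) * (Y j / x))" .
  have l: "0 \<le> 1 / lam" "1 / lam \<le> 1" using lam_bounds by auto
  have yx: "1 / M \<le> Y j / x" "Y j / x \<le> M" using x x0 Y0 M0 by (auto simp: field_simps)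
  have tl: "1 \<le> t + 1 / lam" "t + 1 / lam \<le> 2 * M" using t l M_bounds by linarith+
  have "1 * (1 / M) \<le> (t + 1 / lam) * (Y j / x)" using tl yx M0 by (intro mult_mono) auto
  then have "d * (1 / M) \<le> \<bar>rpoly (F j) (xi a b w)\<bar>" unfolding eq by (intro mult_left_mono) (auto simp: d_def)
  then have "d \<le> M * \<bar>rpoly (F j) (xi a b w)\<bar>" using M0 by (simp add: field_simps)
  also have "\<dots> \<le> K * \<bar>rpoly (F j) (xi a b w)\<bar>" using K_ge by (intro mult_right_mono) auto
  finally show "\<bar>xi a b w - \<alpha> j\<bar> \<le> K * \<bar>rpoly (F j) (xi a b w)\<bar>" by (simp add: d_def)
  have "(t + 1 / lam) * (Y j / x) \<le> (2 * M) * M" using tl yx M_bounds x0 Y0 by (intro mult_mono) auto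
  also have "\<dots> \<le> 9 * M\<^sup>2" by (simp add: power2_eq_square)
  also have "\<dots> \<le> K" by (rule K_ge)
  finally show "\<bar>rpoly (F j) (xi a b w)\<bar> \<le> K * \<bar>xi a b w - \<alpha> j\<bar>"
    unfolding eq d_def[symmetric] by (subst mult.commute, intro mult_right_mono) (auto simp: d_def)
qed

lemma quadratic_approximations_xi:
  "quadratic_approximations (xi a b w) w K \<alpha> (\<lambda>j. (Y j)\<^sup>2) F"
proof
  show "w > 0" using w_ge by simp
  show "K \<ge> 1" by (rule K_ge)
  show "\<bar>xi a b w\<bar> \<le> 1" using cfrac_value_bounds by (simp add: xi_eq c_def)
  show "\<bar>\<alpha> j\<bar> \<le> 1" for j using alpha_bounds[of j] by simp
  show "1 \<le> (Y j)\<^sup>2" for j using Y_ge(1)[of j] by (simp add: one_le_power)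
  have le: "real j \<le> (Y j)\<^sup>2" for j
  proof -
    have "Y j * 1 \<le> Y j * Y j" using Y_ge(1)[of j] by (intro mult_left_mono) auto
    then show ?thesis using Y_ge(2)[of j] by (simp add: power2_eq_square)
  qed
  show "filterlim (\<lambda>j. (Y j)\<^sup>2) at_top sequentially"
    by (rule filterlim_at_top_mono[OF filterlim_real_sequentially]) (simp add: le)
  show "\<exists>C. \<forall>j. \<bar>ln ((Y (Suc j))\<^sup>2) - w * ln ((Y j)\<^sup>2)\<bar> \<le> \<epsilon> * ln ((Y j)\<^sup>2) + C" if "\<epsilon> > 0" for \<epsilon>
    by (rule Y_square_growth) fact
  show "is_int_min_poly (\<alpha> j) (F j)" for j by (rule is_int_min_poly_F)
  show "degree (F j) = 2" for j by (rule degree_F)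
  show "(Y j)\<^sup>2 \<le> K * of_int (lead_coeff (F j))" for j
  proof -
    have "2 * M ^ 4 * \<bar>real_of_int (coeff (G j) 2)\<bar> \<le> K * \<bar>of_int (coeff (G j) 2)\<bar>"
      unfolding K_def by (intro mult_right_mono) auto
    then show ?thesis using G_lead_bound[of j] unfolding lead_F of_int_abs by linarith
  qed
  show "\<bar>of_int (coeff (F j) i)\<bar> \<le> K * (Y j)\<^sup>2" for j i by (rule coeff_F_bound)
  show "1 \<le> K * (Y (Suc j))\<^sup>2 * \<bar>xi a b w - \<alpha> j\<bar>" "(Y (Suc j))\<^sup>2 * \<bar>xi a b w - \<alpha> j\<bar> \<le> K" for j
    by (rule xi_alpha_dist)+
  show "\<bar>xi a b w - \<alpha> j\<bar> \<le> K * \<bar>rpoly (F j) (xi a b w)\<bar>"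
    "\<bar>rpoly (F j) (xi a b w)\<bar> \<le> K * \<bar>xi a b w - \<alpha> j\<bar>" for j by (rule rpoly_F_xi)+
  show "\<exists>c>0. \<forall>j P. degree P \<le> n \<longrightarrow> rpoly P (\<alpha> j) \<noteq> 0 \<longrightarrow>
      c \<le> \<bar>rpoly P (\<alpha> j)\<bar> * of_int (poly_height P) * ((Y j)\<^sup>2) ^ n" for n
    using rpoly_alpha_lower_bound[of _ n]
    by (intro exI[of _ "1 / ((real n + 1) * 2 ^ n)"]) (auto simp: add_pos_pos)
qed

end

theorem theorem5p4:
  fixes d :: nat and w :: real and a b :: int
  assumes "d \<ge> 2"
    and "w \<ge> (3 * real d + 2 + sqrt (9 * (real d)\<^sup>2 + 4 * real d + 4)) / 2"
    and "a > 0" and "b > 0" and "a \<noteq> b"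
  shows "\<forall>n. 2 \<le> n \<and> n \<le> d \<longrightarrow>
           w_star_exp n (xi a b w) = ereal (w - 1) \<and> w_exp n (xi a b w) = ereal w"
proof (intro allI impI)
  fix n assume n: "2 \<le> n \<and> n \<le> d"
  define s where "s = sqrt (9 * (real d)\<^sup>2 + 4 * real d + 4)"
  have s: "s \<ge> 0" "s\<^sup>2 = 9 * (real d)\<^sup>2 + 4 * real d + 4" by (auto simp: s_def)
  have d2: "real d \<ge> 2" using assms(1) by simp
  have ws: "s \<le> 2 * w - (3 * real d + 2)" using assms(2) by (simp add: s_def)
  have w: "w \<ge> 4" "real d < w" using ws s(1) d2 by linarith+
  \<comment> \<open>Squaring turns the hypothesis into w^2 - (3 d + 2) w + 2 d \<ge> 0, which is the
    quadratic inequality for n = d.\<close>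
  have "s\<^sup>2 \<le> (2 * w - (3 * real d + 2))\<^sup>2" using ws s(1) by (intro power_mono)
  then have "2 * real d * w \<le> (w - 2) * (w - real d)"
    unfolding s(2) by (simp add: power2_eq_square algebra_simps)
  \<comment> \<open>Lowering d to n enlarges the difference of the two sides by exactly this
    product.\<close>
  moreover have "0 \<le> (real d - real n) * (3 * w - 2)" using n w by (intro mult_nonneg_nonneg) auto
  ultimately have quad: "2 * real n * w \<le> (w - 2) * (w - real n)" by (simp add: algebra_simps)
  interpret sparse_cfrac a b w by unfold_locales (use assms w in auto)
  interpret quadratic_approximations "xi a b w" w K \<alpha> "\<lambda>j. (Y j)\<^sup>2" F
    by (rule quadratic_approximations_xi)
  have "real n < w" using n w by simp
  then show "w_star_exp n (xi a b w) = ereal (w - 1) \<and> w_exp n (xi a b w) = ereal w"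
    using n quad w_star_exp_eq[of n] w_exp_eq[of n] by blast
qed

end
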